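(* For any AFSM $(\mathcal F,\mathcal R)$: if there is an infinite $(\mathit{SDP}(\mathcal R),\mathcal R)$-chain $[(\rho_0,s_0,t_0),(\rho_1,s_1,t_1),\dots]$ in which every $\rho_i$ is conservative, then $\to_{\mathcal R}$ is non-terminating.
   Context: Types, terms, substitutions, rules. Fix a set $\mathcal S$ of sorts; types are sorts and $\sigma\to\tau$ ($\to$ right-associative). Fix disjoint sets $\mathcal F$ (function symbols), $\mathcal V$ (variables), $\mathcal M$ (meta-variables), each symbol typed, each meta-variable $Z$ with a natural number $\mathit{arity}(Z)$; $\mathcal V,\mathcal M$ contain infinitely many symbols of every type. Meta-terms: $x:\sigma$ ($x:\sigma\in\mathcal V$); $\mathsf f:\sigma$ ($\mathsf f:\sigma\in\mathcal F$); $s\,t:\tau$ if $s:\sigma\to\tau,t:\sigma$; $\lambda x.s:\sigma\to\tau$ if $x:\sigma\in\mathcal V,s:\tau$; $Z\langle s_1,..,s_k\rangle:\sigma_{k+1}\to\cdots\to\iota$ if $Z:\sigma_1\to\cdots\to\sigma_m\to\iota$ has arity $k$ and $s_i:\sigma_i$ (write $Z$ for $Z\langle\rangle$). Terms are meta-terms without meta-variables. Application left-associative; $\lambda$ binds; modulo $\alpha$; $FV,FMV$ are free variables and meta-variables; closed means no free variables. A pattern is $Z\langle x_1,..,x_k\rangle$ (distinct variables), $\lambda x.\ell$ ($\ell$ a pattern), or $a\,\ell_1\cdots\ell_n$ ($a\in\mathcal F\cup\mathcal V$, $\ell_i$ patterns). Substitutions $\gamma$ map variables and meta-variables type-preservingly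 to meta-terms (to terms for a substitution); the domain consists of $x$ with $\gamma(x)\ne x$ and $Z$ of arity $k$ with $\gamma(Z)\ne\lambda y_1..y_k.Z\langle y_1,..,y_k\rangle$. Application is homomorphic and capture-avoiding, except $Z\langle s_1,..,s_k\rangle\gamma=u[x_1:=s_1\gamma,..,x_n:=s_n\gamma](s_{n+1}\gamma)\cdots(s_k\gamma)$ when $Z\in\mathrm{dom}(\gamma)$ and $\gamma(Z)=\lambda x_1..x_n.u$ with $n=k$, or $n<k$ and $u$ not an abstraction. A rule is a pair $\ell\Rightarrow r$ of closed meta-terms of the same type, $\ell$ a pattern $\mathsf f\,\ell_1\cdots\ell_n$ ($\mathsf f\in\mathcal F$), $FMV(r)\subseteq FMV(\ell)$. $\to_{\mathcal R}$ is the smallest relation on terms closed under all contexts (including under $\lambda$) containing $\ell\delta\to r\delta$ for rules and substitutions with $\mathrm{dom}(\delta)=FMV(\ell)$, and $(\lambda x.s)t\to s[x:=t]$. Defined symbols $\mathcal D$: symbols heading some rule's left-hand side. An AFSM is a pair $(\mathcal F,\mathcal R)$. For each $\mathsf f\in\mathcal D$ a natural number $\mathit{minar}(\mathsf f)$ is fixed (when the AFSM is properly applied, it is the number of arguments of $\mathsf f$ in all left-hand sides; otherwise any fixed choice). Static dependency pairs: $\mathcal F^\sharp=\mathcal F\uplus\{\mathsf f^\sharp:\sigma\mid\mathsf f:\sigma\in\mathcal D\}$; for $s=\mathsf f\,s_1\cdots s_k$ with $\mathsf f\in\mathcal D$, $k=\mathit{minar}(\mathsf f)$, let $s^\sharp=\mathsf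 f^\sharp s_1\cdots s_k$. A dependency pair (DP) is a triple $\ell\Rrightarrow p\ (A)$ with $\ell$ a closed pattern $\mathsf f\,\ell_1\cdots\ell_k$, $p$ a closed meta-term $\mathsf g\,p_1\cdots p_n$, and $A$ a set of meta-variable conditions $Z:i$; it is conservative if $FMV(p)\subseteq FMV(\ell)$. A substitution $\gamma$ respects $A$ if for all $Z:i\in A$, $\gamma(Z)=\lambda x_1..x_j.t$ with $i>j$, or $i\le j$ and $x_i\in FV(t)$. Define $s\trianglerighteq^\beta_A t$ by: $s=t$; or $s=\lambda x.u$ and $u\trianglerighteq^\beta_A t$; or $s=(\lambda x.u)\,s_0\cdots s_n$ and some $s_i\trianglerighteq^\beta_A t$ or $u[x:=s_0]\,s_1\cdots s_n\trianglerighteq^\beta_A t$; or $s=a\,s_1\cdots s_n$ with $a\in\mathcal F\cup\mathcal V$ and some $s_i\trianglerighteq^\beta_A t$; or $s=Z\langle t_1,..,t_e\rangle\,s_1\cdots s_n$ and some $s_i\trianglerighteq^\beta_A t$; or $s=Z\langle t_1,..,t_e\rangle\,s_1\cdots s_n$ and $t_i\trianglerighteq^\beta_A t$ for some $i$ with $(Z:i)\in A$. $\mathsf{cand}(s)$ consists of the pairs $t\ (A)$ with $t=\mathsf f\,s_1\cdots s_k$, $\mathsf f\in\mathcal D$, $k=\mathit{minar}(\mathsf f)$, such that $s\trianglerighteq^\beta_A t\,s_{k+1}\cdots s_n$ for some $s_{k+1},..,s_n$, and no $A'\subsetneq A$ has $s\trianglerighteq^\beta_{A'}t$. $\mathit{metafy}(s)$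 replaces every free variable of $s$ by a corresponding fresh arity-$0$ meta-variable. $\mathit{SDP}(\mathcal R)=\{\ell^\sharp\Rrightarrow\mathit{metafy}(p^\sharp)\ (A)\mid\ell\Rightarrow r\in\mathcal R,\ p\ (A)\in\mathsf{cand}(r)\}$. Chains: a $(\mathcal P,\mathcal R)$-chain (for a set $\mathcal P$ of DPs) is a sequence $[(\ell_0\Rrightarrow p_0\,(A_0),s_0,t_0),\dots]$ with each DP in $\mathcal P$, $s_i,t_i$ terms over $\mathcal F^\sharp$, such that for all $i$: some substitution $\gamma$ with domain $FMV(\ell_i)\cup FMV(p_i)$ respects $A_i$ and has $s_i=\ell_i\gamma$, $t_i=p_i\gamma$; and $t_i=\mathsf f\,u_1\cdots u_n$, $s_{i+1}=\mathsf f\,w_1\cdots w_n$ with each $u_j\to^*_{\mathcal R}w_j$. *)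

theory Defs
  imports Main
begin

datatype 's ty = Sort 's | Fun "'s ty" "'s ty"

fun arg_types :: "'s ty \<Rightarrow> 's ty list" where
  "arg_types (Sort \<iota>) = []"
| "arg_types (Fun \<sigma> \<tau>) = \<sigma> # arg_types \<tau>"

text \<open>
  Meta-terms modulo \<open>\<alpha>\<close> in locally nameless style: free variables are the symbols
  \<open>Free x\<close>, bound ones are de Bruijn indices.  The named abstraction \<open>\<lambda>x. s\<close> is the
  derived operation \<open>lam x s\<close> below, and all later notions are phrased with it.
  The set functions \<open>FV\<close> and \<open>FMV\<close> of the datatype are the free variables and the
  meta-variables of a meta-term.
\<close>

datatype (funs: 'f, FV: 'v, FMV: 'm, sorts: 's) mterm =
    Free 'v
  | Bnd nat
  | Fn 'f
  | App "('f, 'v, 'm, 's) mterm" "('f, 'v, 'm, 's) mterm"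
  | Abs "'s ty" "('f, 'v, 'm, 's) mterm"
  | Meta 'm "('f, 'v, 'm, 's) mterm list"

abbreviation apps :: "('f, 'v, 'm, 's) mterm \<Rightarrow> ('f, 'v, 'm, 's) mterm list \<Rightarrow> ('f, 'v, 'm, 's) mterm" where
  "apps \<equiv> foldl App"

fun is_abs :: "('f, 'v, 'm, 's) mterm \<Rightarrow> bool" where
  "is_abs (Abs \<sigma> t) = True"
| "is_abs t = False"

fun shift :: "nat \<Rightarrow> nat \<Rightarrow> ('f, 'v, 'm, 's) mterm \<Rightarrow> ('f, 'v, 'm, 's) mterm" where
  "shift d c (Free x) = Free x"
| "shift d c (Bnd i) = (if i < c then Bnd i else Bnd (i + d))"
| "shift d c (Fn f) = Fn f"
| "shift d c (App s t) = App (shift d c s) (shift d c t)"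
| "shift d c (Abs \<sigma> t) = Abs \<sigma> (shift d (Suc c) t)"
| "shift d c (Meta Z ts) = Meta Z (map (shift d c) ts)"

text \<open>
  \<open>inst c ss t\<close> removes the \<open>length ss\<close> binders at level \<open>c\<close>, simultaneously replacing
  the index \<open>c + i\<close> by \<open>ss ! i\<close>.
\<close>

fun inst :: "nat \<Rightarrow> ('f, 'v, 'm, 's) mterm list \<Rightarrow> ('f, 'v, 'm, 's) mterm \<Rightarrow> ('f, 'v, 'm, 's) mterm" where
  "inst c ss (Free x) = Free x"
| "inst c ss (Bnd i) =
    (if i < c then Bnd i
     else if i - c < length ss then shift c 0 (ss ! (i - c))
     else Bnd (i - length ss))"
| "inst c ss (Fn f) = Fn f"
| "inst c ss (App s t) = App (inst c ss s) (inst c ss t)"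
| "inst c ss (Abs \<sigma> t) = Abs \<sigma> (inst (Suc c) ss t)"
| "inst c ss (Meta Z ts) = Meta Z (map (inst c ss) ts)"

fun bind :: "nat \<Rightarrow> 'v \<Rightarrow> ('f, 'v, 'm, 's) mterm \<Rightarrow> ('f, 'v, 'm, 's) mterm" where
  "bind c x (Free y) = (if y = x then Bnd c else Free y)"
| "bind c x (Bnd i) = (if i < c then Bnd i else Bnd (Suc i))"
| "bind c x (Fn f) = Fn f"
| "bind c x (App s t) = App (bind c x s) (bind c x t)"
| "bind c x (Abs \<sigma> t) = Abs \<sigma> (bind (Suc c) x t)"
| "bind c x (Meta Z ts) = Meta Z (map (bind c x) ts)"

text \<open>
  \<open>strip_abs k t = (n, u)\<close> writes \<open>t\<close> as \<open>n\<close> abstractions over \<open>u\<close>, where \<open>n = k\<close>, or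
  \<open>n < k\<close> and \<open>u\<close> is not an abstraction.
\<close>

fun strip_abs :: "nat \<Rightarrow> ('f, 'v, 'm, 's) mterm \<Rightarrow> nat \<times> ('f, 'v, 'm, 's) mterm" where
  "strip_abs (Suc k) (Abs \<sigma> t) = (case strip_abs k t of (n, u) \<Rightarrow> (Suc n, u))"
| "strip_abs k t = (0, t)"

text \<open>
  \<open>meta_app (\<lambda>x\<^sub>1\<dots>x\<^sub>n. u) [s\<^sub>1,\<dots>,s\<^sub>k] = u[x\<^sub>1 := s\<^sub>1,\<dots>,x\<^sub>n := s\<^sub>n] s\<^sub>n\<^sub>+\<^sub>1 \<dots> s\<^sub>k\<close>; the list is
  reversed because index \<open>0\<close> is the innermost binder \<open>x\<^sub>n\<close>.
\<close>

definition meta_app :: "('f, 'v, 'm, 's) mterm \<Rightarrow> ('f, 'v, 'm, 's) mterm list \<Rightarrow> ('f, 'v, 'm, 's) mterm" where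
  "meta_app t ss =
    (case strip_abs (length ss) t of (n, u) \<Rightarrow> apps (inst 0 (rev (take n ss)) u) (drop n ss))"

type_synonym ('f, 'v, 'm, 's) subst = "'v + 'm \<Rightarrow> ('f, 'v, 'm, 's) mterm"

type_synonym ('f, 'v, 'm, 's) rule = "('f, 'v, 'm, 's) mterm \<times> ('f, 'v, 'm, 's) mterm"

type_synonym ('f, 'v, 'm, 's) dp =
  "('f, 'v, 'm, 's) mterm \<times> ('f, 'v, 'm, 's) mterm \<times> ('m \<times> nat) set"

definition defined_symbols :: "('f, 'v, 'm, 's) rule set \<Rightarrow> 'f set" where
  "defined_symbols R = {f. \<exists>ls r. (apps (Fn f) ls, r) \<in> R}"

definition conservative :: "('f, 'v, 'm, 's) dp \<Rightarrow> bool" where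
  "conservative \<rho> = (case \<rho> of (l, p, A) \<Rightarrow> FMV p \<subseteq> FMV l)"

text \<open>
  A set of typed function symbols is a partial map from names to types.
\<close>

type_synonym ('f, 's) sig = "'f \<Rightarrow> 's ty option"

datatype 'f marked = Plain 'f | Sharp 'f

fun sharp_sig :: "('f, 's) sig \<Rightarrow> ('f, 'v, 'm, 's) rule set \<Rightarrow> ('f marked, 's) sig" where
  "sharp_sig F R (Plain f) = F f"
| "sharp_sig F R (Sharp f) = (if f \<in> defined_symbols R then F f else None)"

definition plain :: "('f, 'v, 'm, 's) mterm \<Rightarrow> ('f marked, 'v, 'm, 's) mterm" where
  "plain = map_mterm Plain id id id"

definition plain_rules :: "('f, 'v, 'm, 's) rule set \<Rightarrow> ('f marked, 'v, 'm, 's) rule set" where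
  "plain_rules R = {(plain l, plain r) | l r. (l, r) \<in> R}"

locale symbols =
  fixes vty :: "'v \<Rightarrow> 's ty"
    and mty :: "'m \<Rightarrow> 's ty"
    and arity :: "'m \<Rightarrow> nat"
  assumes infinite_vars: "infinite {x. vty x = \<sigma>}"
    and infinite_mvars: "infinite {Z. mty Z = \<sigma>}"
    and arity_le: "arity Z \<le> length (arg_types (mty Z))"
begin

inductive has_type :: "('f, 's) sig \<Rightarrow> 's ty list \<Rightarrow> ('f, 'v, 'm, 's) mterm \<Rightarrow> 's ty \<Rightarrow> bool"
  for F :: "('f, 's) sig" where
  "has_type F \<Gamma> (Free x) (vty x)"
| "i < length \<Gamma> \<Longrightarrow> has_type F \<Gamma> (Bnd i) (\<Gamma> ! i)"
| "F f = Some \<sigma> \<Longrightarrow> has_type F \<Gamma> (Fn f) \<sigma>"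
| "has_type F \<Gamma> s (Fun \<sigma> \<tau>) \<Longrightarrow> has_type F \<Gamma> t \<sigma> \<Longrightarrow> has_type F \<Gamma> (App s t) \<tau>"
| "has_type F (\<sigma> # \<Gamma>) s \<tau> \<Longrightarrow> has_type F \<Gamma> (Abs \<sigma> s) (Fun \<sigma> \<tau>)"
| "length ss = arity Z \<Longrightarrow> mty Z = foldr Fun \<sigma>s \<tau> \<Longrightarrow> list_all2 (has_type F \<Gamma>) ss \<sigma>s
    \<Longrightarrow> has_type F \<Gamma> (Meta Z ss) \<tau>"

definition is_mterm :: "('f, 's) sig \<Rightarrow> ('f, 'v, 'm, 's) mterm \<Rightarrow> bool" where
  "is_mterm F s \<longleftrightarrow> (\<exists>\<sigma>. has_type F [] s \<sigma>)"

definition is_term :: "('f, 's) sig \<Rightarrow> ('f, 'v, 'm, 's) mterm \<Rightarrow> bool" where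
  "is_term F s \<longleftrightarrow> is_mterm F s \<and> FMV s = {}"

definition lam :: "'v \<Rightarrow> ('f, 'v, 'm, 's) mterm \<Rightarrow> ('f, 'v, 'm, 's) mterm" where
  "lam x s = Abs (vty x) (bind 0 x s)"

definition lams :: "'v list \<Rightarrow> ('f, 'v, 'm, 's) mterm \<Rightarrow> ('f, 'v, 'm, 's) mterm" where
  "lams xs s = foldr lam xs s"

inductive pattern :: "('f, 'v, 'm, 's) mterm \<Rightarrow> bool" where
  "distinct xs \<Longrightarrow> pattern (Meta Z (map Free xs))"
| "pattern l \<Longrightarrow> pattern (lam x l)"
| "(\<And>l. l \<in> set ls \<Longrightarrow> pattern l) \<Longrightarrow> pattern (apps (Fn f) ls)"
| "(\<And>l. l \<in> set ls \<Longrightarrow> pattern l) \<Longrightarrow> pattern (apps (Free x) ls)"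

text \<open>\<open>meta_id Z\<close> is \<open>\<lambda>y\<^sub>1\<dots>y\<^sub>k. Z\<langle>y\<^sub>1,\<dots>,y\<^sub>k\<rangle>\<close> for \<open>k = arity Z\<close>.\<close>

definition meta_id :: "'m \<Rightarrow> ('f, 'v, 'm, 's) mterm" where
  "meta_id Z = foldr Abs (take (arity Z) (arg_types (mty Z))) (Meta Z (map Bnd (rev [0..<arity Z])))"

definition sdom :: "('f, 'v, 'm, 's) subst \<Rightarrow> ('v + 'm) set" where
  "sdom \<gamma> = {Inl x | x. \<gamma> (Inl x) \<noteq> Free x} \<union> {Inr Z | Z. \<gamma> (Inr Z) \<noteq> meta_id Z}"

definition is_subst :: "('f, 's) sig \<Rightarrow> ('f, 'v, 'm, 's) subst \<Rightarrow> bool" where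
  "is_subst F \<gamma> \<longleftrightarrow>
    (\<forall>x. has_type F [] (\<gamma> (Inl x)) (vty x)) \<and>
    (\<forall>Z. has_type F [] (\<gamma> (Inr Z)) (mty Z)) \<and>
    (\<forall>a\<in>sdom \<gamma>. is_term F (\<gamma> a))"

text \<open>
  No shifting is needed below \<open>Abs\<close>: the values of a substitution have no dangling indices.
\<close>

fun subst :: "('f, 'v, 'm, 's) subst \<Rightarrow> ('f, 'v, 'm, 's) mterm \<Rightarrow> ('f, 'v, 'm, 's) mterm" where
  "subst \<gamma> (Free x) = \<gamma> (Inl x)"
| "subst \<gamma> (Bnd i) = Bnd i"
| "subst \<gamma> (Fn f) = Fn f"
| "subst \<gamma> (App s t) = App (subst \<gamma> s) (subst \<gamma> t)"
| "subst \<gamma> (Abs \<sigma> t) = Abs \<sigma> (subst \<gamma> t)"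
| "subst \<gamma> (Meta Z ts) =
    (if Inr Z \<in> sdom \<gamma> then meta_app (\<gamma> (Inr Z)) (map (subst \<gamma>) ts)
     else Meta Z (map (subst \<gamma>) ts))"

definition var_subst :: "('v \<Rightarrow> ('f, 'v, 'm, 's) mterm) \<Rightarrow> ('f, 'v, 'm, 's) subst" where
  "var_subst g = case_sum g meta_id"

definition subst1 :: "'v \<Rightarrow> ('f, 'v, 'm, 's) mterm \<Rightarrow> ('f, 'v, 'm, 's) mterm \<Rightarrow> ('f, 'v, 'm, 's) mterm" where
  "subst1 x t s = subst (var_subst (Free(x := t))) s"

definition is_rule :: "('f, 's) sig \<Rightarrow> ('f, 'v, 'm, 's) rule \<Rightarrow> bool" where
  "is_rule F \<rho> = (case \<rho> of (l, r) \<Rightarrow>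
    (\<exists>\<sigma>. has_type F [] l \<sigma> \<and> has_type F [] r \<sigma>) \<and> FV l = {} \<and> FV r = {} \<and>
    pattern l \<and> (\<exists>f ls. l = apps (Fn f) ls) \<and> FMV r \<subseteq> FMV l)"

definition afsm :: "('f, 's) sig \<Rightarrow> ('f, 'v, 'm, 's) rule set \<Rightarrow> bool" where
  "afsm F R \<longleftrightarrow> (\<forall>\<rho>\<in>R. is_rule F \<rho>)"

inductive red :: "('f, 's) sig \<Rightarrow> ('f, 'v, 'm, 's) rule set \<Rightarrow>
    ('f, 'v, 'm, 's) mterm \<Rightarrow> ('f, 'v, 'm, 's) mterm \<Rightarrow> bool"
  for F :: "('f, 's) sig" and R :: "('f, 'v, 'm, 's) rule set" where
  "(l, r) \<in> R \<Longrightarrow> is_subst F \<delta> \<Longrightarrow> sdom \<delta> = Inr ` FMV l \<Longrightarrow> red F R (subst \<delta> l) (subst \<delta> r)"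
| "is_term F (App (lam x s) t) \<Longrightarrow> red F R (App (lam x s) t) (subst1 x t s)"
| "red F R s s' \<Longrightarrow> is_term F (App s t) \<Longrightarrow> red F R (App s t) (App s' t)"
| "red F R t t' \<Longrightarrow> is_term F (App s t) \<Longrightarrow> red F R (App s t) (App s t')"
| "red F R s s' \<Longrightarrow> red F R (lam x s) (lam x s')"

text \<open>
  In \<open>\<gamma> Z = \<lambda>x\<^sub>1\<dots>x\<^sub>j. t\<close> all leading abstractions are displayed; for arbitrary \<open>j\<close> every
  condition would hold through \<open>j = 0\<close>.
\<close>

definition respects_conds :: "('f, 'v, 'm, 's) subst \<Rightarrow> ('m \<times> nat) set \<Rightarrow> bool" where
  "respects_conds \<gamma> A \<longleftrightarrow> (\<forall>(Z, i)\<in>A. \<exists>xs t. \<gamma> (Inr Z) = lams xs t \<and> distinct xs \<and> \<not> is_abs t \<and>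
    (i > length xs \<or> 1 \<le> i \<and> i \<le> length xs \<and> xs ! (i - 1) \<in> FV t))"

inductive beta_sub :: "('m \<times> nat) set \<Rightarrow> ('f, 'v, 'm, 's) mterm \<Rightarrow> ('f, 'v, 'm, 's) mterm \<Rightarrow> bool"
  for A :: "('m \<times> nat) set" where
  "beta_sub A s s"
| "beta_sub A u t \<Longrightarrow> beta_sub A (lam x u) t"
| "s \<in> set ss \<Longrightarrow> beta_sub A s t \<Longrightarrow> beta_sub A (apps (lam x u) ss) t"
| "beta_sub A (apps (subst1 x s u) ss) t \<Longrightarrow> beta_sub A (apps (lam x u) (s # ss)) t"
| "s \<in> set ss \<Longrightarrow> beta_sub A s t \<Longrightarrow> beta_sub A (apps (Fn f) ss) t"
| "s \<in> set ss \<Longrightarrow> beta_sub A s t \<Longrightarrow> beta_sub A (apps (Free x) ss) t"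
| "s \<in> set ss \<Longrightarrow> beta_sub A s t \<Longrightarrow> beta_sub A (apps (Meta Z ts) ss) t"
| "(Z, i) \<in> A \<Longrightarrow> 1 \<le> i \<Longrightarrow> i \<le> length ts \<Longrightarrow> beta_sub A (ts ! (i - 1)) t
    \<Longrightarrow> beta_sub A (apps (Meta Z ts) ss) t"

definition cand :: "('f, 'v, 'm, 's) rule set \<Rightarrow> ('f \<Rightarrow> nat) \<Rightarrow> ('f, 'v, 'm, 's) mterm \<Rightarrow>
    (('f, 'v, 'm, 's) mterm \<times> ('m \<times> nat) set) set" where
  "cand R minar s = {(t, A).
    (\<exists>f ts. t = apps (Fn f) ts \<and> f \<in> defined_symbols R \<and> length ts = minar f) \<and>
    (\<exists>us. beta_sub A s (apps t us)) \<and> \<not> (\<exists>A'. A' \<subset> A \<and> beta_sub A' s t)}"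

text \<open>\<open>is_sharp R minar s s'\<close>: the meta-term \<open>s\<^sup>\<sharp>\<close> is defined and equal to \<open>s'\<close>.\<close>

definition is_sharp :: "('f, 'v, 'm, 's) rule set \<Rightarrow> ('f \<Rightarrow> nat) \<Rightarrow>
    ('f, 'v, 'm, 's) mterm \<Rightarrow> ('f marked, 'v, 'm, 's) mterm \<Rightarrow> bool" where
  "is_sharp R minar s s' \<longleftrightarrow> (\<exists>f ss. s = apps (Fn f) ss \<and> f \<in> defined_symbols R \<and>
    length ss = minar f \<and> s' = apps (Fn (Sharp f)) (map plain ss))"

text \<open>
  \<open>is_metafy M s s'\<close>: \<open>s'\<close> is \<open>metafy(s)\<close> for some choice of pairwise distinct fresh
  meta-variables outside \<open>M\<close>.  All choices are admitted, so \<open>SDP\<close> is closed under renaming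
  of the fresh meta-variables.
\<close>

definition is_metafy :: "'m set \<Rightarrow> ('f, 'v, 'm, 's) mterm \<Rightarrow> ('f, 'v, 'm, 's) mterm \<Rightarrow> bool" where
  "is_metafy M s s' \<longleftrightarrow> (\<exists>\<xi>. inj_on \<xi> (FV s) \<and>
    (\<forall>x\<in>FV s. mty (\<xi> x) = vty x \<and> arity (\<xi> x) = 0 \<and> \<xi> x \<notin> M) \<and>
    s' = subst (var_subst (\<lambda>x. if x \<in> FV s then Meta (\<xi> x) [] else Free x)) s)"

definition SDP :: "('f, 'v, 'm, 's) rule set \<Rightarrow> ('f \<Rightarrow> nat) \<Rightarrow> ('f marked, 'v, 'm, 's) dp set" where
  "SDP R minar = {(l', q, A) | l' q A. \<exists>l r p p'.
    (l, r) \<in> R \<and> (p, A) \<in> cand R minar r \<and> is_sharp R minar l l' \<and> is_sharp R minar p p' \<and>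
    is_metafy (FMV l' \<union> FMV p' \<union> fst ` A) p' q}"

text \<open>
  Here \<open>F\<close> and \<open>R\<close> are meant to be \<open>sharp_sig\<close> and \<open>plain_rules\<close> of the given AFSM.
\<close>

definition infinite_chain :: "('f, 's) sig \<Rightarrow> ('f, 'v, 'm, 's) dp set \<Rightarrow> ('f, 'v, 'm, 's) rule set \<Rightarrow>
    (nat \<Rightarrow> ('f, 'v, 'm, 's) dp \<times> ('f, 'v, 'm, 's) mterm \<times> ('f, 'v, 'm, 's) mterm) \<Rightarrow> bool" where
  "infinite_chain F P R C \<longleftrightarrow> (\<forall>i. case C i of ((l, p, A), s, t) \<Rightarrow>
    (l, p, A) \<in> P \<and> is_term F s \<and> is_term F t \<and>
    (\<exists>\<gamma>. is_subst F \<gamma> \<and> sdom \<gamma> = Inr ` (FMV l \<union> FMV p) \<and> respects_conds \<gamma> A \<and>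
      s = subst \<gamma> l \<and> t = subst \<gamma> p) \<and>
    (\<exists>f us ws. t = apps (Fn f) us \<and> fst (snd (C (Suc i))) = apps (Fn f) ws \<and>
      list_all2 (red F R)\<^sup>*\<^sup>* us ws))"

definition terminating :: "('f, 's) sig \<Rightarrow> ('f, 'v, 'm, 's) rule set \<Rightarrow> bool" where
  "terminating F R \<longleftrightarrow> \<not> (\<exists>u. \<forall>i::nat. red F R (u i) (u (Suc i)))"

end

end

theory Submission
  imports Defs
begin

text \<open>
  A conservative static dependency pair introduces no fresh meta-variables, so after erasing the
  marks each chain element \<open>s\<^sub>i = \<ell>\<gamma>\<close> rewrites to \<open>r\<gamma>\<close>, and \<open>p\<gamma>\<close> is reached from \<open>r\<gamma>\<close> by \<open>\<beta>\<close>-steps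
  and passing to subterms: the conditions in \<open>A\<close> ensure that the arguments of a meta-variable
  survive instantiation. Rewriting is closed under contexts, so a subterm step followed by a
  rewrite step can be turned into a rewrite step followed by a subterm step. Postponing all subterm
  steps leaves an infinite reduction.
\<close>

text \<open>Conservativity has two less visible effects. A free variable of a candidate
  \<open>p\<close> would become a meta-variable foreign to the left-hand side, so \<open>p\<close>
  is closed; this is crucial because descending below a binder of \<open>r\<close> replaces its
  variable by one fresh for the instance, and only a closed \<open>p\<close> has an image
  independent of that choice. Moreover, the domain of \<open>\<gamma>\<close> becomes exactly the
  set of meta-variables of the left-hand side, as a rule step demands.

  The encoding is the other obstacle. Meta-variables are instantiated through de Bruijn indices,
  whereas rewriting and subterms are phrased with named abstractions; closedness and fresh variables
  mediate between the two. Finally, the application contexts of \<open>red\<close> admit only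
  well-typed terms, so typing must accompany every exchange of steps, which calls for subject
  reduction.\<close>

section \<open>De Bruijn calculus: closedness, instantiation, stripped binders\<close>

fun closed_at :: "nat \<Rightarrow> ('f, 'v, 'm, 's) mterm \<Rightarrow> bool" where
  "closed_at k (Free x) = True"
| "closed_at k (Bnd i) = (i < k)"
| "closed_at k (Fn f) = True"
| "closed_at k (App s t) = (closed_at k s \<and> closed_at k t)"
| "closed_at k (Abs \<sigma> t) = closed_at (Suc k) t"
| "closed_at k (Meta Z ts) = (\<forall>t\<in>set ts. closed_at k t)"

lemma closed_at_mono: "closed_at k t \<Longrightarrow> k \<le> k' \<Longrightarrow> closed_at k' t"
proof (induction t arbitrary: k k')
  case (Abs \<sigma> t) then show ?case using Suc_le_mono by (metis closed_at.simps(5))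
qed auto

lemma shift_closed: "closed_at c t \<Longrightarrow> shift d c t = t"
  by (induction t arbitrary: c) (auto intro: map_idI)

lemma inst_closed: "closed_at c t \<Longrightarrow> inst c ws t = t"
  by (induction t arbitrary: c) (auto intro: map_idI)

text \<open>Shifting sends every index from \<open>c\<close> on to at least \<open>d + c\<close>, so
  the bound on the result excludes such indices. This recovers closedness of a value from its copy
  below \<open>d\<close> binders.\<close>

lemma closed_at_shiftD: "closed_at (d + c) (shift d c t) \<Longrightarrow> closed_at c t"
proof (induction t arbitrary: c)
  case (Abs \<sigma> t) then show ?case by (metis add_Suc_right closed_at.simps(5) shift.simps(5))
qed (auto split: if_splits)

lemma closed_at_apps [simp]: "closed_at k (apps h ts) \<longleftrightarrow> closed_at k h \<and> (\<forall>t\<in>set ts. closed_at k t)"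
  by (induction ts arbitrary: h) auto

lemma inst_apps: "inst c ws (apps h ts) = apps (inst c ws h) (map (inst c ws) ts)"
  by (induction ts arbitrary: h) auto

lemma FMV_apps: "FMV (apps h ts) = FMV h \<union> \<Union>(FMV ` set ts)"
  by (induction ts arbitrary: h) auto

text \<open>The shift inserts \<open>d\<close> levels inside the instantiated ones
  (\<open>e \<le> c\<close>), which merely raises the instantiation level; the closed values
  \<open>ws\<close> are unaffected by shifting.\<close>

lemma inst_shift:
  "\<forall>w\<in>set ws. closed_at 0 w \<Longrightarrow> e \<le> c \<Longrightarrow> inst (c + d) ws (shift d e a) = shift d e (inst c ws a)"
proof (induction a arbitrary: c e)
  case (Bnd i)
  have "shift k j w = w" if "w \<in> set ws" for w k j
    using that Bnd(1) closed_at_mono[of 0 w j] by (simp add: shift_closed)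
  with Bnd show ?case by (auto simp: less_diff_conv2)
next
  case (Abs \<sigma> a)
  then show ?case using Abs.IH[of "Suc e" "Suc c"] by simp
qed auto

text \<open>De Bruijn substitution lemma. By the bound on \<open>u\<close>, the outer instantiation
  meets only indices that came in through \<open>as\<close>.\<close>

lemma inst_inst:
  assumes "\<forall>w\<in>set ws. closed_at 0 w"
  shows "closed_at (d + length as) u \<Longrightarrow> inst (c + d) ws (inst d as u) = inst d (map (inst c ws) as) u"
proof (induction u arbitrary: d)
  case (Bnd i)
  show ?case using Bnd assms inst_shift[of ws 0 c d] by (auto simp: less_diff_conv2)
next
  case (Abs \<sigma> u)
  then show ?case using Abs.IH[of "Suc d"] by simp
qed auto

lemma closed_at_strip_abs: "strip_abs k t = (n, u) \<Longrightarrow> closed_at c t \<Longrightarrow> closed_at (c + n) u"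
  by (induction k t arbitrary: n u c rule: strip_abs.induct) (auto split: prod.splits, metis add_Suc)

lemma strip_abs_le: "strip_abs k t = (n, u) \<Longrightarrow> n \<le> k"
  by (induction k t arbitrary: n u rule: strip_abs.induct) (auto split: prod.splits)

lemma FMV_strip_abs: "strip_abs k t = (n, u) \<Longrightarrow> FMV u = FMV t"
  by (induction k t arbitrary: n u rule: strip_abs.induct) (auto split: prod.splits)

lemma FV_strip_abs: "strip_abs k t = (n, u) \<Longrightarrow> FV u = FV t"
  by (induction k t arbitrary: n u rule: strip_abs.induct) (auto split: prod.splits)

text \<open>Binding a variable never creates or destroys a leading abstraction; inside the body it
  acts \<open>n\<close> levels deeper.\<close>

lemma strip_abs_bind: "strip_abs k t = (n, u) \<Longrightarrow> strip_abs k (bind c x t) = (n, bind (c + n) x u)"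
proof (induction k t arbitrary: n u c rule: strip_abs.induct)
  case (1 k \<sigma> t)
  obtain m v where mv: "strip_abs k t = (m, v)" by fastforce
  from 1(1)[OF mv, of "Suc c"] 1(2) mv show ?case by auto
qed auto

text \<open>The body stripped from a closed \<open>v\<close> has dangling indices only for the
  \<open>n\<close> removed binders, so \<open>inst_inst\<close> applies at depth
  \<open>0\<close>.\<close>

lemma inst_meta_app:
  assumes "\<forall>w\<in>set ws. closed_at 0 w" "closed_at 0 v"
  shows "inst c ws (meta_app v ss) = meta_app v (map (inst c ws) ss)"
proof -
  obtain n u where nu: "strip_abs (length ss) v = (n, u)" by fastforce
  have "n \<le> length ss" "closed_at n u"
    using strip_abs_le[OF nu] closed_at_strip_abs[OF nu assms(2)] by auto
  then show ?thesis
    using nu inst_inst[OF assms(1), of 0 "rev (take n ss)" u c]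
    by (simp add: meta_app_def inst_apps rev_map take_map drop_map)
qed

lemma FMV_shift [simp]: "FMV (shift d c t) = FMV t"
  by (induction t arbitrary: c) auto

lemma FMV_inst: "FMV (inst c ws t) \<subseteq> FMV t \<union> \<Union>(FMV ` set ws)"
proof (induction t arbitrary: c)
  case (App s t)
  then show ?case by simp blast
next
  case (Meta Z ts)
  then show ?case by auto
qed (auto intro: nth_mem)

lemma FMV_bind [simp]: "FMV (bind c x t) = FMV t"
  by (induction t arbitrary: c) auto

lemma FV_bind [simp]: "FV (bind c x t) = FV t - {x}"
  by (induction t arbitrary: c) auto

lemma FMV_meta_app: "FMV (meta_app v ss) \<subseteq> FMV v \<union> \<Union>(FMV ` set ss)"
proof -
  obtain n u where nu: "strip_abs (length ss) v = (n, u)" by fastforce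
  show ?thesis
    using nu FMV_strip_abs[OF nu] FMV_inst[of 0 "rev (take n ss)" u]
    by (auto simp: meta_app_def FMV_apps dest: in_set_takeD in_set_dropD)
qed

lemma finite_FV: "finite (FV t)"
  by (induction t) auto

lemma inst_bind: "inst c [Free x] (bind c x t) = t"
  by (induction t arbitrary: c) (auto simp: map_idI)

lemma bind_inst: "x \<notin> FV t \<Longrightarrow> bind c x (inst c [Free x] t) = t"
  by (induction t arbitrary: c) (auto simp: map_idI)

lemma strip_abs_not_abs: "\<not> is_abs t \<Longrightarrow> strip_abs k t = (0, t)"
  by (cases k; cases t) auto

text \<open>Lets \<open>size\<close> serve as induction measure when an abstraction is opened with a
  variable.\<close>

lemma size_inst_Free: "size (inst c [Free x] t) = size t"
  by (induction t arbitrary: c) (auto intro: size_list_pointwise order.antisym simp: size_list_conv_sum_list cong: map_cong)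

section \<open>Occurrences that survive instantiation, and subterms with dangling indices\<close>

text \<open>Occurrences below meta-variables do not count, as they need not survive a substitution.\<close>

fun occurs :: "nat \<Rightarrow> ('f, 'v, 'm, 's) mterm \<Rightarrow> bool" where
  "occurs m (Bnd i) = (i = m)"
| "occurs m (App s t) = (occurs m s \<or> occurs m t)"
| "occurs m (Abs \<sigma> t) = occurs (Suc m) t"
| "occurs m _ = False"

lemma occurs_bind_self: "x \<in> FV t \<Longrightarrow> FMV t = {} \<Longrightarrow> occurs c (bind c x t)"
  by (induction t arbitrary: c) auto

lemma occurs_bind: "occurs m t \<Longrightarrow> m < c \<Longrightarrow> occurs m (bind c x t)"
  by (induction t arbitrary: m c) auto

text \<open>An occurring index leaves a shifted copy of \<open>ws ! m\<close> in the result, which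
  inherits the bound. Arguments of a meta-variable are shown closed this way, starting from
  closedness of the whole instance.\<close>

lemma closed_at_inst_occurs:
  "closed_at d (inst d ws u) \<Longrightarrow> occurs (d + m) u \<Longrightarrow> m < length ws \<Longrightarrow> closed_at 0 (ws ! m)"
proof (induction u arbitrary: d)
  case (Bnd i) then show ?case using closed_at_shiftD[of d 0] by auto
qed auto

text \<open>This agrees with \<open>sub\<^sup>*\<^sup>*\<close> on targets without dangling
  indices, because opening an abstraction does not change these.\<close>

inductive raw_sub :: "('f, 'v, 'm, 's) mterm \<Rightarrow> ('f, 'v, 'm, 's) mterm \<Rightarrow> bool" where
  "raw_sub w w"
| "raw_sub s w \<Longrightarrow> raw_sub (App s t) w"
| "raw_sub t w \<Longrightarrow> raw_sub (App s t) w"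
| "raw_sub t w \<Longrightarrow> raw_sub (Abs \<sigma> t) w"

text \<open>The closed target is fixed by instantiation, so the same descent reaches it in the
  instance.\<close>

lemma raw_sub_inst: "raw_sub v w \<Longrightarrow> closed_at 0 w \<Longrightarrow> raw_sub (inst c ws v) w"
proof (induction arbitrary: c rule: raw_sub.induct)
  case (1 w)
  then show ?case using inst_closed closed_at_mono raw_sub.intros(1) by (metis zero_le)
qed (auto intro: raw_sub.intros)

lemma raw_sub_inst_occurs:
  "occurs (d + m) u \<Longrightarrow> m < length ws \<Longrightarrow> closed_at 0 (ws ! m) \<Longrightarrow> raw_sub (inst d ws u) (ws ! m)"
  by (induction u arbitrary: d) (auto simp: shift_closed intro: raw_sub.intros)

section \<open>Erasing marks\<close>

text \<open>\<open>Sharp f\<close> has the type of \<open>f\<close>, so merging the two copies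
  respects typing and turns a marked left-hand side back into that of the rule.\<close>

fun unmark_sym :: "'f marked \<Rightarrow> 'f" where
  "unmark_sym (Plain f) = f"
| "unmark_sym (Sharp f) = f"

definition unmark :: "('f marked, 'v, 'm, 's) mterm \<Rightarrow> ('f, 'v, 'm, 's) mterm" where
  "unmark = map_mterm unmark_sym id id id"

lemma unmark_simps [simp]:
  "unmark (Free x) = Free x"
  "unmark (Bnd i) = Bnd i"
  "unmark (Fn f) = Fn (unmark_sym f)"
  "unmark (App s t) = App (unmark s) (unmark t)"
  "unmark (Abs \<sigma> t) = Abs \<sigma> (unmark t)"
  "unmark (Meta Z ts) = Meta Z (map unmark ts)"
  by (simp_all add: unmark_def ty.map_id)

lemma unmark_plain [simp]: "unmark (plain t) = t"
  by (simp add: unmark_def plain_def mterm.map_comp o_def mterm.map_ident)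

lemma unmark_apps: "unmark (apps h ts) = apps (unmark h) (map unmark ts)"
  by (induction ts arbitrary: h) auto

lemma unmark_shift: "unmark (shift d c t) = shift d c (unmark t)"
  by (induction t arbitrary: c) auto

lemma unmark_inst: "unmark (inst c ws t) = inst c (map unmark ws) (unmark t)"
  by (induction t arbitrary: c) (auto simp: unmark_shift)

lemma unmark_bind: "unmark (bind c x t) = bind c x (unmark t)"
  by (induction t arbitrary: c) auto

lemma is_abs_unmark [simp]: "is_abs (unmark t) = is_abs t"
  by (cases t) auto

lemma strip_abs_unmark: "strip_abs k (unmark t) = map_prod id unmark (strip_abs k t)"
  by (induction k t rule: strip_abs.induct) (auto split: prod.splits)

lemma unmark_meta_app: "unmark (meta_app v ss) = meta_app (unmark v) (map unmark ss)"
  by (auto simp: meta_app_def strip_abs_unmark unmark_apps unmark_inst rev_map take_map drop_map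
    split: prod.splits)

lemma FV_unmark [simp]: "FV (unmark t) = FV t"
  by (simp add: unmark_def mterm.set_map)

lemma FMV_unmark [simp]: "FMV (unmark t) = FMV t"
  by (simp add: unmark_def mterm.set_map)

lemma FMV_plain [simp]: "FMV (plain t) = FMV t"
  by (simp add: plain_def mterm.set_map)

section \<open>Substitution and named abstraction\<close>

context symbols
begin

lemma sdom_Inr [simp]: "Inr Z \<in> sdom \<gamma> \<longleftrightarrow> \<gamma> (Inr Z) \<noteq> meta_id Z"
  by (auto simp: sdom_def)

lemma var_subst_simps [simp]: "var_subst g (Inl x) = g x" "var_subst g (Inr Z) = meta_id Z"
  by (simp_all add: var_subst_def)

lemma subst_apps: "subst \<gamma> (apps h ts) = apps (subst \<gamma> h) (map (subst \<gamma>) ts)"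
  by (induction ts arbitrary: h) auto

lemma subst_var_Free [simp]: "subst (var_subst Free) t = t"
  by (induction t) (auto simp: map_idI)

text \<open>Holds constructor by constructor: \<open>subst\<close> never shifts, and
  \<open>subst1\<close> keeps every \<open>Meta\<close> in place.\<close>

lemma subst_subst1: "subst \<gamma> (subst1 x s u) = subst (\<gamma>(Inl x := subst \<gamma> s)) u"
  unfolding subst1_def
proof (induction u)
  case (Meta Z ts)
  then show ?case by (simp cong: map_cong)
qed auto

lemma subst_cong:
  "(\<And>x. x \<in> FV t \<Longrightarrow> \<gamma> (Inl x) = \<gamma>' (Inl x)) \<Longrightarrow> (\<And>Z. \<gamma> (Inr Z) = \<gamma>' (Inr Z)) \<Longrightarrow>
    subst \<gamma> t = subst \<gamma>' t"
proof (induction t)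
  case (Meta Z ts)
  then have "map (subst \<gamma>) ts = map (subst \<gamma>') ts" by auto
  with Meta.prems(2) show ?case by (simp del: map_eq_conv)
qed auto

text \<open>\<open>var_subst\<close> instantiates no meta-variable, so no argument gets erased and
  the image of every free variable survives.\<close>

lemma FMV_subst_var: "x \<in> FV t \<Longrightarrow> FMV (g x) \<subseteq> FMV (subst (var_subst g) t)"
  by (induction t) auto

text \<open>This is what makes the absence of shifting in \<open>subst\<close> sound. At
  meta-variables only the values in the domain are ever inserted.\<close>

definition closed_subst :: "('f, 'v, 'm, 's) subst \<Rightarrow> bool" where
  "closed_subst \<gamma> \<longleftrightarrow> (\<forall>x. closed_at 0 (\<gamma> (Inl x))) \<and> (\<forall>Z. Inr Z \<in> sdom \<gamma> \<longrightarrow> closed_at 0 (\<gamma> (Inr Z)))"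

lemma closed_subst_upd: "closed_subst \<gamma> \<Longrightarrow> closed_at 0 w \<Longrightarrow> closed_subst (\<gamma>(Inl x := w))"
  by (simp add: closed_subst_def)

text \<open>The bridge between the two styles: substituting below a nameless binder and then filling
  it amounts to extending the substitution at the named variable.\<close>

lemma inst_subst_bind:
  assumes "closed_subst \<gamma>" "closed_at 0 w"
  shows "inst c [w] (subst \<gamma> (bind c x u)) = subst (\<gamma>(Inl x := w)) u"
proof (induction u arbitrary: c)
  case (Free y)
  have "closed_at c (\<gamma> (Inl y))"
    using assms(1) closed_at_mono by (fastforce simp: closed_subst_def)
  then show ?case using assms(2) by (simp add: inst_closed shift_closed)
next
  case (Meta Z ts)
  show ?case
  proof (cases "Inr Z \<in> sdom \<gamma>")
    case True
    then have "closed_at 0 (\<gamma> (Inr Z))" using assms(1) by (simp add: closed_subst_def)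
    then show ?thesis using True Meta assms(2) by (simp add: inst_meta_app o_def cong: map_cong)
  next
    case False
    then show ?thesis using Meta by simp
  qed
qed auto

lemma subst1_eq_inst: "closed_at 0 w \<Longrightarrow> subst1 x w u = inst 0 [w] (bind 0 x u)"
proof -
  assume w: "closed_at 0 w"
  have "closed_subst (var_subst Free)" by (simp add: closed_subst_def var_subst_def)
  from inst_subst_bind[OF this w, of 0 x u]
  have "inst 0 [w] (bind 0 x u) = subst ((var_subst Free)(Inl x := w)) u" by simp
  also have "(var_subst Free)(Inl x := w) = var_subst (Free(x := w))"
    by (auto simp: var_subst_def fun_eq_iff split: sum.splits)
  finally show ?thesis by (simp add: subst1_def)
qed

lemma lam_inst: "x \<notin> FV t \<Longrightarrow> lam x (inst 0 [Free x] t) = Abs (vty x) t"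
  by (simp add: lam_def bind_inst)

lemma fresh_var: obtains x where "vty x = \<sigma>" "x \<notin> FV t"
proof -
  have "infinite ({x. vty x = \<sigma>} - FV t)" using infinite_vars finite_FV by (rule Diff_infinite_finite[rotated])
  then have "{x. vty x = \<sigma>} - FV t \<noteq> {}" by (rule infinite_imp_nonempty)
  then show ?thesis using that by blast
qed

text \<open>Capture avoidance: \<open>y\<close> is chosen of the type of \<open>x\<close> and fresh
  for the substituted body, so the nameless image is again a named abstraction. The second property
  computes its \<beta>-contractum.\<close>

lemma subst_lam:
  assumes "closed_subst \<gamma>"
  obtains y where "subst \<gamma> (lam x u) = lam y (subst (\<gamma>(Inl x := Free y)) u)"
    "\<And>w. closed_at 0 w \<Longrightarrow> subst1 y w (subst (\<gamma>(Inl x := Free y)) u) = subst (\<gamma>(Inl x := w)) u"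
proof -
  let ?b = "subst \<gamma> (bind 0 x u)"
  obtain y where y: "vty y = vty x" "y \<notin> FV ?b" by (rule fresh_var)
  have o: "inst 0 [Free y] ?b = subst (\<gamma>(Inl x := Free y)) u"
    using inst_subst_bind[OF assms, of "Free y"] by simp
  have l: "lam y (subst (\<gamma>(Inl x := Free y)) u) = Abs (vty x) ?b"
    using lam_inst[OF y(2)] o y(1) by simp
  show ?thesis
  proof (rule that)
    show "subst \<gamma> (lam x u) = lam y (subst (\<gamma>(Inl x := Free y)) u)"
      unfolding l by (simp add: lam_def)
    show "subst1 y w (subst (\<gamma>(Inl x := Free y)) u) = subst (\<gamma>(Inl x := w)) u"
      if w: "closed_at 0 w" for w
      using l inst_subst_bind[OF assms w, of 0 x u] by (simp add: subst1_eq_inst[OF w] lam_def)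
  qed
qed

lemma lams_simps [simp]: "lams [] t = t" "lams (x # xs) t = lam x (lams xs t)"
  by (simp_all add: lams_def)

lemma FV_lams: "FV (lams xs t) = FV t - set xs"
  by (induction xs) (auto simp: lam_def)

lemma FMV_lams: "FMV (lams xs t) = FMV t"
  by (induction xs) (auto simp: lam_def)

lemma strip_abs_lams_le: "\<not> is_abs t \<Longrightarrow> strip_abs k (lams xs t) = (n, u) \<Longrightarrow> n \<le> length xs"
proof (induction xs arbitrary: k n u)
  case Nil then show ?case by (simp add: strip_abs_not_abs)
next
  case (Cons x xs)
  show ?case
  proof (cases k)
    case (Suc j)
    obtain m v where mv: "strip_abs j (lams xs t) = (m, v)" by fastforce
    from Cons.IH[OF Cons.prems(1) mv] Cons.prems(2) Suc strip_abs_bind[OF mv, of 0 x]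
    show ?thesis by (auto simp: lam_def)
  qed (use Cons in \<open>simp add: lam_def\<close>)
qed

text \<open>Positions count from the outermost binder, indices from the innermost, hence
  \<open>n - 1 - i\<close>. Since no meta-variables are present, every free occurrence of
  \<open>xs ! i\<close> is one that \<open>occurs\<close> counts.\<close>

lemma strip_abs_lams_occurs:
  "distinct xs \<Longrightarrow> i < length xs \<Longrightarrow> xs ! i \<in> FV t \<Longrightarrow> FMV t = {} \<Longrightarrow>
    strip_abs k (lams xs t) = (n, u) \<Longrightarrow> i < n \<Longrightarrow> occurs (n - 1 - i) u"
proof (induction xs arbitrary: k n u i)
  case (Cons x xs)
  show ?case
  proof (cases k)
    case (Suc j)
    obtain m v where mv: "strip_abs j (lams xs t) = (m, v)" by fastforce
    have n: "n = Suc m" and u: "u = bind m x v"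
      using Cons.prems(5) Suc strip_abs_bind[OF mv, of 0 x] by (auto simp: lam_def)
    show ?thesis
    proof (cases i)
      case 0
      then have "x \<in> FV v" using Cons.prems FV_strip_abs[OF mv] by (simp add: FV_lams)
      moreover have "FMV v = {}" using Cons.prems FMV_strip_abs[OF mv] by (simp add: FMV_lams)
      ultimately show ?thesis using 0 by (simp add: n u occurs_bind_self)
    next
      case (Suc i')
      then have "occurs (m - 1 - i') v" using Cons.IH[OF _ _ _ _ mv] Cons.prems n by auto
      then show ?thesis using Suc Cons.prems(6) n by (auto simp: u intro: occurs_bind)
    qed
  qed (use Cons in \<open>simp add: lam_def\<close>)
qed simp

section \<open>Typing\<close>

lemma has_type_closed: "has_type F \<Gamma> t \<sigma> \<Longrightarrow> closed_at (length \<Gamma>) t"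
  by (induction rule: has_type.induct) (auto simp: list_all2_conv_all_nth in_set_conv_nth)

lemma has_type_weaken: "has_type F \<Gamma> t \<sigma> \<Longrightarrow> has_type F (\<Gamma> @ \<Gamma>') t \<sigma>"
proof (induction rule: has_type.induct)
  case (2 i \<Gamma>)
  then show ?case using has_type.intros(2)[of i "\<Gamma> @ \<Gamma>'"] by (simp add: nth_append)
next
  case (6 ss Z \<sigma>s \<tau> \<Gamma>)
  then show ?case by (auto intro: has_type.intros(6) elim: list_all2_mono)
qed (auto intro: has_type.intros)

lemma has_type_shift:
  "has_type F \<Gamma> t \<sigma> \<Longrightarrow> \<Gamma> = \<Gamma>\<^sub>0 @ \<Gamma>\<^sub>2 \<Longrightarrow>
    has_type F (\<Gamma>\<^sub>0 @ \<Gamma>\<^sub>1 @ \<Gamma>\<^sub>2) (shift (length \<Gamma>\<^sub>1) (length \<Gamma>\<^sub>0) t) \<sigma>"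
proof (induction arbitrary: \<Gamma>\<^sub>0 rule: has_type.induct)
  case (2 i \<Gamma>)
  let ?j = "if i < length \<Gamma>\<^sub>0 then i else i + length \<Gamma>\<^sub>1"
  have "?j < length (\<Gamma>\<^sub>0 @ \<Gamma>\<^sub>1 @ \<Gamma>\<^sub>2)" "(\<Gamma>\<^sub>0 @ \<Gamma>\<^sub>1 @ \<Gamma>\<^sub>2) ! ?j = \<Gamma> ! i"
    using 2 by (auto simp: nth_append)
  then show ?case using has_type.intros(2)[of ?j "\<Gamma>\<^sub>0 @ \<Gamma>\<^sub>1 @ \<Gamma>\<^sub>2" F] by (simp split: if_splits)
next
  case (5 \<sigma> \<Gamma> s \<tau>)
  then show ?case using "5.IH"[of "\<sigma> # \<Gamma>\<^sub>0"] by (simp add: has_type.intros(5))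
next
  case (6 ss Z \<sigma>s \<tau> \<Gamma>)
  have "list_all2 (has_type F (\<Gamma>\<^sub>0 @ \<Gamma>\<^sub>1 @ \<Gamma>\<^sub>2)) (map (shift (length \<Gamma>\<^sub>1) (length \<Gamma>\<^sub>0)) ss) \<sigma>s"
    unfolding list_all2_map1 using "6.IH" by (rule list_all2_mono) (use "6.prems" in simp)
  with 6(1,2) show ?case by (simp add: has_type.intros(6))
next
  case (4 \<Gamma> s \<sigma> \<tau> t)
  show ?case using has_type.intros(4)[OF "4.IH"(1)[OF "4.prems"] "4.IH"(2)[OF "4.prems"]] by simp
qed (simp_all add: has_type.intros(1,3))

lemma has_type_bind:
  "has_type F \<Gamma> t \<sigma> \<Longrightarrow> \<Gamma> = \<Gamma>\<^sub>0 @ \<Gamma>\<^sub>2 \<Longrightarrow>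
    has_type F (\<Gamma>\<^sub>0 @ vty x # \<Gamma>\<^sub>2) (bind (length \<Gamma>\<^sub>0) x t) \<sigma>"
proof (induction arbitrary: \<Gamma>\<^sub>0 rule: has_type.induct)
  case (1 \<Gamma> y)
  then show ?case
    using has_type.intros(1) has_type.intros(2)[of "length \<Gamma>\<^sub>0" "\<Gamma>\<^sub>0 @ vty x # \<Gamma>\<^sub>2"] by auto
next
  case (2 i \<Gamma>)
  let ?j = "if i < length \<Gamma>\<^sub>0 then i else Suc i"
  have "?j < length (\<Gamma>\<^sub>0 @ vty x # \<Gamma>\<^sub>2)" "(\<Gamma>\<^sub>0 @ vty x # \<Gamma>\<^sub>2) ! ?j = \<Gamma> ! i"
    using 2 by (auto simp: nth_append Suc_diff_le)
  then show ?case using has_type.intros(2)[of ?j "\<Gamma>\<^sub>0 @ vty x # \<Gamma>\<^sub>2" F] by (simp split: if_splits)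
next
  case (5 \<sigma> \<Gamma> s \<tau>)
  then show ?case using "5.IH"[of "\<sigma> # \<Gamma>\<^sub>0"] by (simp add: has_type.intros(5))
next
  case (6 ss Z \<sigma>s \<tau> \<Gamma>)
  have "list_all2 (has_type F (\<Gamma>\<^sub>0 @ vty x # \<Gamma>\<^sub>2)) (map (bind (length \<Gamma>\<^sub>0) x) ss) \<sigma>s"
    unfolding list_all2_map1 using "6.IH" by (rule list_all2_mono) (use "6.prems" in simp)
  with 6(1,2) show ?case by (simp add: has_type.intros(6))
next
  case (4 \<Gamma> s \<sigma> \<tau> t)
  show ?case using has_type.intros(4)[OF "4.IH"(1)[OF "4.prems"] "4.IH"(2)[OF "4.prems"]] by simp
qed (simp_all add: has_type.intros(1,3))

lemma has_type_inst:
  assumes "list_all2 (has_type F \<Gamma>\<^sub>2) ws \<sigma>s"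
  shows "has_type F \<Gamma> t \<tau> \<Longrightarrow> \<Gamma> = \<Gamma>\<^sub>0 @ \<sigma>s @ \<Gamma>\<^sub>2 \<Longrightarrow> has_type F (\<Gamma>\<^sub>0 @ \<Gamma>\<^sub>2) (inst (length \<Gamma>\<^sub>0) ws t) \<tau>"
proof (induction arbitrary: \<Gamma>\<^sub>0 rule: has_type.induct)
  case (2 i \<Gamma>)
  have len: "length ws = length \<sigma>s" using assms by (rule list_all2_lengthD)
  consider "i < length \<Gamma>\<^sub>0" | "length \<Gamma>\<^sub>0 \<le> i" "i - length \<Gamma>\<^sub>0 < length \<sigma>s" | "length \<Gamma>\<^sub>0 + length \<sigma>s \<le> i"
    by linarith
  then show ?case
  proof cases
    case 1
    then show ?thesis using has_type.intros(2)[of i "\<Gamma>\<^sub>0 @ \<Gamma>\<^sub>2"] 2 by (simp add: nth_append)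
  next
    case c: 2
    have "has_type F \<Gamma>\<^sub>2 (ws ! (i - length \<Gamma>\<^sub>0)) (\<sigma>s ! (i - length \<Gamma>\<^sub>0))"
      using assms c len by (simp add: list_all2_conv_all_nth)
    from has_type_shift[OF this, of "[]" \<Gamma>\<^sub>2 \<Gamma>\<^sub>0] show ?thesis
      using c len 2 by (simp add: nth_append)
  next
    case 3
    then have "\<not> i < length \<Gamma>\<^sub>0" "\<not> i - length \<Gamma>\<^sub>0 < length \<sigma>s" "i - length \<sigma>s < length (\<Gamma>\<^sub>0 @ \<Gamma>\<^sub>2)"
      "(\<Gamma>\<^sub>0 @ \<Gamma>\<^sub>2) ! (i - length \<sigma>s) = \<Gamma> ! i"
      using 2 by (auto simp: nth_append add.commute)
    then show ?thesis using has_type.intros(2)[of "i - length \<sigma>s" "\<Gamma>\<^sub>0 @ \<Gamma>\<^sub>2" F] len by simp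
  qed
next
  case (5 \<sigma> \<Gamma> s \<tau>)
  then show ?case using "5.IH"[of "\<sigma> # \<Gamma>\<^sub>0"] by (simp add: has_type.intros(5))
next
  case (6 ss Z \<sigma>s \<tau> \<Gamma>)
  have "list_all2 (has_type F (\<Gamma>\<^sub>0 @ \<Gamma>\<^sub>2)) (map (inst (length \<Gamma>\<^sub>0) ws) ss) \<sigma>s"
    unfolding list_all2_map1 using "6.IH" by (rule list_all2_mono) (use "6.prems" in simp)
  with 6(1,2) show ?case by (simp add: has_type.intros(6))
next
  case (4 \<Gamma> s \<sigma> \<tau> t)
  show ?case using has_type.intros(4)[OF "4.IH"(1)[OF "4.prems"] "4.IH"(2)[OF "4.prems"]] by simp
qed (simp_all add: has_type.intros(1,3))

inductive_cases has_type_AppE: "has_type F \<Gamma> (App s t) \<tau>"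
inductive_cases has_type_AbsE: "has_type F \<Gamma> (Abs \<sigma> t) \<tau>"

lemma has_type_apps:
  "list_all2 (has_type F \<Gamma>) ts \<sigma>s \<Longrightarrow> has_type F \<Gamma> h (foldr Fun \<sigma>s \<tau>) \<Longrightarrow> has_type F \<Gamma> (apps h ts) \<tau>"
  by (induction arbitrary: h rule: list_all2_induct) (auto intro: has_type.intros)

text \<open>The stripped types enter the context reversed, because index \<open>0\<close> is the
  innermost binder.\<close>

lemma has_type_strip_abs:
  "strip_abs (length \<sigma>s) v = (n, u) \<Longrightarrow> has_type F \<Gamma> v (foldr Fun \<sigma>s \<tau>) \<Longrightarrow>
    has_type F (rev (take n \<sigma>s) @ \<Gamma>) u (foldr Fun (drop n \<sigma>s) \<tau>)"
proof (induction "length \<sigma>s" v arbitrary: \<sigma>s n u \<Gamma> rule: strip_abs.induct)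
  case (1 k \<sigma> t)
  then obtain \<sigma>' \<sigma>s' where \<sigma>s: "\<sigma>s = \<sigma>' # \<sigma>s'" "k = length \<sigma>s'" by (cases \<sigma>s) auto
  obtain m w where mw: "strip_abs k t = (m, w)" by fastforce
  have "has_type F (\<sigma> # \<Gamma>) t (foldr Fun \<sigma>s' \<tau>)" "\<sigma>' = \<sigma>"
    using "1.prems"(2) \<sigma>s by (auto elim: has_type_AbsE)
  then show ?case using "1.hyps"(1)[of \<sigma>s' m w "\<sigma> # \<Gamma>"] mw "1.prems"(1) \<sigma>s "1.hyps"(2) by auto
qed auto

lemma has_type_meta_app:
  assumes "list_all2 (has_type F \<Gamma>) ss \<sigma>s" "has_type F \<Gamma> v (foldr Fun \<sigma>s \<tau>)"
  shows "has_type F \<Gamma> (meta_app v ss) \<tau>"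
proof -
  obtain n u where nu: "strip_abs (length ss) v = (n, u)" by fastforce
  have len: "length ss = length \<sigma>s" using assms(1) by (rule list_all2_lengthD)
  have u: "has_type F (rev (take n \<sigma>s) @ \<Gamma>) u (foldr Fun (drop n \<sigma>s) \<tau>)"
    using has_type_strip_abs nu assms(2) len by metis
  have "list_all2 (has_type F \<Gamma>) (rev (take n ss)) (rev (take n \<sigma>s))"
    using assms(1) by (simp add: list_all2_takeI)
  from has_type_inst[OF this u, of "[]"]
  have "has_type F \<Gamma> (inst 0 (rev (take n ss)) u) (foldr Fun (drop n \<sigma>s) \<tau>)" by simp
  moreover have "list_all2 (has_type F \<Gamma>) (drop n ss) (drop n \<sigma>s)"
    using assms(1) by (simp add: list_all2_dropI)
  ultimately show ?thesis using nu by (simp add: meta_app_def has_type_apps)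
qed

lemma has_type_subst:
  assumes "is_subst F \<gamma>"
  shows "has_type F \<Gamma> t \<tau> \<Longrightarrow> has_type F \<Gamma> (subst \<gamma> t) \<tau>"
proof (induction rule: has_type.induct)
  case (1 \<Gamma> x)
  then show ?case using assms has_type_weaken[of F "[]" _ _ \<Gamma>] by (simp add: is_subst_def)
next
  case (6 ss Z \<sigma>s \<tau> \<Gamma>)
  have *: "list_all2 (has_type F \<Gamma>) (map (subst \<gamma>) ss) \<sigma>s"
    using "6.IH" by (auto simp: list_all2_map1 elim: list_all2_mono)
  have "has_type F \<Gamma> (\<gamma> (Inr Z)) (foldr Fun \<sigma>s \<tau>)"
    using assms 6(2) has_type_weaken[of F "[]" _ _ \<Gamma>] by (metis append_Nil is_subst_def)
  from has_type_meta_app[OF * this] show ?case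
    using has_type.intros(6)[OF _ 6(2) *] 6(1) by simp
qed (auto intro: has_type.intros)

lemma foldr_Fun_inj:
  "length \<sigma>s = length \<sigma>s' \<Longrightarrow> foldr Fun \<sigma>s \<tau> = foldr Fun \<sigma>s' \<tau>' \<Longrightarrow> \<tau> = \<tau>'"
  by (induction rule: list_induct2) auto

text \<open>For \<open>Meta\<close> the arity fixes the number of arguments, so both decompositions
  of its type cut at the same place.\<close>

lemma has_type_unique: "has_type F \<Gamma> t \<sigma> \<Longrightarrow> has_type F \<Gamma> t \<sigma>' \<Longrightarrow> \<sigma> = \<sigma>'"
proof (induction arbitrary: \<sigma>' rule: has_type.induct)
  case (6 ss Z \<sigma>s \<tau> \<Gamma>)
  note Z = 6(2) and len = list_all2_lengthD[OF 6(3)]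
  from 6(4) show ?case
  proof cases
    case (6 \<sigma>s')
    show ?thesis
      using foldr_Fun_inj[of \<sigma>s \<sigma>s' \<tau> \<sigma>'] Z 6(2) len list_all2_lengthD[OF 6(3)] by simp
  qed
next
  case (4 \<Gamma> s \<sigma> \<tau> t)
  then show ?case by (fast elim: has_type_AppE)
next
  case (5 \<sigma> \<Gamma> s \<tau>)
  then show ?case by (fast elim: has_type_AbsE)
next
  case (1 \<Gamma> x)
  then show ?case by cases simp
next
  case (2 i \<Gamma>)
  from 2(2) show ?case by cases simp
next
  case (3 f \<sigma> \<Gamma>)
  from 3(2) show ?case by cases (use 3(1) in simp)
qed

lemma has_type_lam: "has_type F [] s \<tau> \<Longrightarrow> has_type F [] (lam x s) (Fun (vty x) \<tau>)"
  using has_type_bind[of F "[]" s \<tau> "[]" "[]" x] by (auto simp: lam_def intro: has_type.intros)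

lemma has_type_lamE:
  assumes "has_type F [] (lam x s) \<sigma>"
  obtains \<tau> where "\<sigma> = Fun (vty x) \<tau>" "has_type F [vty x] (bind 0 x s) \<tau>" "has_type F [] s \<tau>"
proof -
  from assms obtain \<tau> where \<tau>: "\<sigma> = Fun (vty x) \<tau>" "has_type F [vty x] (bind 0 x s) \<tau>"
    by (auto simp: lam_def elim: has_type_AbsE)
  from has_type_inst[of F "[]" "[Free x]" "[vty x]", OF _ \<tau>(2), of "[]"]
  have "has_type F [] s \<tau>" by (simp add: inst_bind has_type.intros)
  with \<tau> that show thesis by blast
qed

lemma is_termE:
  assumes "is_term F s" obtains \<sigma> where "has_type F [] s \<sigma>" "FMV s = {}"
  using assms by (auto simp: is_term_def is_mterm_def)

lemma is_termI: "has_type F [] s \<sigma> \<Longrightarrow> FMV s = {} \<Longrightarrow> is_term F s"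
  by (auto simp: is_term_def is_mterm_def)

lemma is_term_closed: "is_term F s \<Longrightarrow> closed_at 0 s"
  by (erule is_termE, drule has_type_closed) simp

lemma is_term_App: "is_term F (App s t) \<Longrightarrow> is_term F s \<and> is_term F t"
  by (auto simp: is_term_def is_mterm_def elim!: has_type_AppE)

lemma is_term_apps: "is_term F (apps h ts) \<Longrightarrow> is_term F h \<and> (\<forall>t\<in>set ts. is_term F t)"
proof (induction ts arbitrary: h)
  case (Cons t ts)
  have "is_term F (App h t)" "\<forall>t\<in>set ts. is_term F t"
    using Cons.IH[of "App h t"] Cons.prems by simp_all
  then show ?case using is_term_App[of F h t] by simp
qed simp

lemma is_term_lamD: "is_term F (lam x s) \<Longrightarrow> is_term F s"
  by (elim is_termE, erule has_type_lamE, rule is_termI) (simp_all add: lam_def)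

lemma FMV_subst_empty:
  assumes "is_subst F \<gamma>" shows "Inr ` FMV t \<subseteq> sdom \<gamma> \<Longrightarrow> FMV (subst \<gamma> t) = {}"
proof (induction t)
  case (Free x)
  have "\<gamma> (Inl x) = Free x \<or> Inl x \<in> sdom \<gamma>" by (auto simp: sdom_def)
  then show ?case using assms by (auto simp: is_subst_def is_term_def)
next
  case (Meta Z ts)
  then have Z: "Inr Z \<in> sdom \<gamma>" by auto
  then have "FMV (\<gamma> (Inr Z)) = {}" using assms by (auto simp: is_subst_def is_term_def)
  moreover have "\<forall>t\<in>set ts. FMV (subst \<gamma> t) = {}" using Meta by auto
  ultimately show ?case using Z FMV_meta_app[of "\<gamma> (Inr Z)" "map (subst \<gamma>) ts"] by auto
qed auto

lemma is_subst_closed: "is_subst F \<gamma> \<Longrightarrow> closed_subst \<gamma>"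
  unfolding is_subst_def closed_subst_def using has_type_closed by (metis list.size(3))

section \<open>Rewriting preserves terms\<close>

text \<open>Subject reduction. For a rule step, the instance of \<open>l\<close> has the common type
  of both sides, and uniqueness of types identifies it with the given type.\<close>

lemma red_has_type:
  assumes R: "afsm F R"
  shows "red F R s s' \<Longrightarrow> has_type F [] s \<sigma> \<Longrightarrow> has_type F [] s' \<sigma>"
proof (induction arbitrary: \<sigma> rule: red.induct)
  case (1 l r \<delta>)
  from R 1(1) obtain \<tau> where "has_type F [] l \<tau>" "has_type F [] r \<tau>"
    by (force simp: afsm_def is_rule_def)
  then show ?case using has_type_subst[OF 1(2)] has_type_unique 1(4) by metis
next
  case (2 x s t)
  then have t: "closed_at 0 t" using is_term_App is_term_closed by blast
  from 2(2) obtain \<tau> where \<tau>: "has_type F [] (lam x s) (Fun \<tau> \<sigma>)" "has_type F [] t \<tau>"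
    by (auto elim: has_type_AppE)
  then have "has_type F [vty x] (bind 0 x s) \<sigma>" "\<tau> = vty x" by (auto elim: has_type_lamE)
  then show ?case
    using has_type_inst[of F "[]" "[t]" "[vty x]" "[vty x]" _ \<sigma> "[]"] \<tau>(2)
    by (simp add: subst1_eq_inst[OF t])
next
  case (5 s s' x)
  from 5(3) obtain \<tau> where "\<sigma> = Fun (vty x) \<tau>" "has_type F [] s \<tau>" by (rule has_type_lamE)
  then show ?case using has_type_lam[OF 5(2)] by simp
next
  case (3 s s' t)
  from "3.prems" obtain \<tau> where "has_type F [] s (Fun \<tau> \<sigma>)" "has_type F [] t \<tau>" by (rule has_type_AppE)
  then show ?case by (auto intro: has_type.intros(4)[of F "[]" _ \<tau>] "3.IH")
next
  case (4 t t' s)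
  from "4.prems" obtain \<tau> where "has_type F [] s (Fun \<tau> \<sigma>)" "has_type F [] t \<tau>" by (rule has_type_AppE)
  then show ?case by (auto intro: has_type.intros(4)[of F "[]" _ \<tau>] "4.IH")
qed

lemma red_FMV:
  assumes R: "afsm F R"
  shows "red F R s s' \<Longrightarrow> FMV s = {} \<Longrightarrow> FMV s' = {}"
proof (induction rule: red.induct)
  case (1 l r \<delta>)
  from R 1(1) have "FMV r \<subseteq> FMV l" by (force simp: afsm_def is_rule_def)
  then show ?case using FMV_subst_empty[OF 1(2)] 1(3) by blast
next
  case (2 x s t)
  then have t: "closed_at 0 t" using is_term_App is_term_closed by blast
  show ?case using FMV_inst[of 0 "[t]" "bind 0 x s"] 2(2) by (simp add: subst1_eq_inst[OF t] lam_def)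
qed (auto simp: lam_def)

lemma red_is_term: "afsm F R \<Longrightarrow> red F R s s' \<Longrightarrow> is_term F s \<Longrightarrow> is_term F s'"
  by (erule is_termE, rule is_termI) (erule red_has_type, assumption+, erule red_FMV)

section \<open>Postponing subterm steps\<close>

text \<open>Abstractions are opened by name, as in the rule of \<open>red\<close> below a binder;
  targets thus have no dangling indices and can themselves be rewritten.\<close>

inductive sub :: "('f, 'v, 'm, 's) mterm \<Rightarrow> ('f, 'v, 'm, 's) mterm \<Rightarrow> bool" where
  "sub (App s t) s"
| "sub (App s t) t"
| "sub (lam x s) s"

lemma sub_is_term: "sub s t \<Longrightarrow> is_term F s \<Longrightarrow> is_term F t"
  by (induction rule: sub.induct) (auto dest: is_term_App is_term_lamD)

lemma subs_is_term: "sub\<^sup>*\<^sup>* s t \<Longrightarrow> is_term F s \<Longrightarrow> is_term F t"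
  by (induction rule: rtranclp_induct) (auto dest: sub_is_term)

lemma reds_is_term: "afsm F R \<Longrightarrow> (red F R)\<^sup>*\<^sup>* s t \<Longrightarrow> is_term F s \<Longrightarrow> is_term F t"
  by (rotate_tac, induction rule: rtranclp_induct) (auto dest: red_is_term)

text \<open>Each kind of immediate subterm has its matching context rule of \<open>red\<close>,
  whose typing condition is supplied by \<open>is_term F u\<close>.\<close>

lemma sub_red: "sub u s \<Longrightarrow> red F R s s' \<Longrightarrow> is_term F u \<Longrightarrow> \<exists>u'. red F R u u' \<and> sub u' s'"
  by (induction rule: sub.induct) (blast intro: red.intros sub.intros)+

lemma subs_red: "sub\<^sup>*\<^sup>* u s \<Longrightarrow> red F R s s' \<Longrightarrow> is_term F u \<Longrightarrow> \<exists>u'. red F R u u' \<and> sub\<^sup>*\<^sup>* u' s'"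
proof (induction arbitrary: s' rule: rtranclp_induct)
  case (step s t)
  then obtain s'' where "red F R s s''" "sub s'' s'" using sub_red subs_is_term by blast
  with step.IH step.prems(2) show ?case by (meson rtranclp.rtrancl_into_rtrancl)
qed auto

text \<open>Descending in an instantiated right-hand side interleaves \<beta>-contractions with
  passing to subterms, so both are merged here and separated later.\<close>

definition step :: "('f, 's) sig \<Rightarrow> ('f, 'v, 'm, 's) rule set \<Rightarrow>
    ('f, 'v, 'm, 's) mterm \<Rightarrow> ('f, 'v, 'm, 's) mterm \<Rightarrow> bool" where
  "step F R s t \<longleftrightarrow> red F R s t \<or> sub s t"

lemma subs_steps: "sub\<^sup>*\<^sup>* s t \<Longrightarrow> (step F R)\<^sup>*\<^sup>* s t"
  by (rule rtranclp_mono[THEN predicate2D]) (auto simp: step_def)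

lemma reds_steps: "(red F R)\<^sup>*\<^sup>* s t \<Longrightarrow> (step F R)\<^sup>*\<^sup>* s t"
  by (rule rtranclp_mono[THEN predicate2D]) (auto simp: step_def)

text \<open>A term containing \<open>s\<close> simulates the sequence: rewrite steps are lifted to
  the surrounding term, subterm steps only lengthen the path to the tracked subterm.\<close>

lemma subs_steps_commute:
  assumes R: "afsm F R"
  shows "(step F R)\<^sup>*\<^sup>* s t \<Longrightarrow> sub\<^sup>*\<^sup>* u s \<Longrightarrow> is_term F u \<Longrightarrow> \<exists>u'. (red F R)\<^sup>*\<^sup>* u u' \<and> sub\<^sup>*\<^sup>* u' t"
proof (induction rule: rtranclp_induct)
  case (step t t')
  then obtain u' where u': "(red F R)\<^sup>*\<^sup>* u u'" "sub\<^sup>*\<^sup>* u' t" by blast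
  then have "is_term F u'" using reds_is_term[OF R] step.prems(2) by blast
  with u' step.hyps(2) show ?case
    unfolding step_def using subs_red by (meson rtranclp.rtrancl_into_rtrancl)
qed auto

lemma sub_apps_head: "sub\<^sup>*\<^sup>* (apps h ts) h"
  by (induction ts rule: rev_induct) (auto intro: sub.intros converse_rtranclp_into_rtranclp)

lemma sub_apps_arg: "t \<in> set ts \<Longrightarrow> sub\<^sup>*\<^sup>* (apps h ts) t"
proof -
  assume "t \<in> set ts"
  then obtain ts1 ts2 where "ts = ts1 @ t # ts2" by (meson split_list)
  then have "apps h ts = apps (App (apps h ts1) t) ts2" by simp
  then have "sub\<^sup>*\<^sup>* (apps h ts) (App (apps h ts1) t)" using sub_apps_head by metis
  then show ?thesis using sub.intros(2) by (rule rtranclp.rtrancl_into_rtrancl)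
qed

lemma red_apps_head: "red F R h h' \<Longrightarrow> is_term F (apps h ts) \<Longrightarrow> red F R (apps h ts) (apps h' ts)"
proof (induction ts rule: rev_induct)
  case (snoc t ts)
  then show ?case using is_term_App by (auto intro: red.intros)
qed simp

lemma reds_apps_head:
  assumes R: "afsm F R"
  shows "(red F R)\<^sup>*\<^sup>* h h' \<Longrightarrow> is_term F (apps h ts) \<Longrightarrow> (red F R)\<^sup>*\<^sup>* (apps h ts) (apps h' ts)"
proof (induction rule: rtranclp_induct)
  case (step h' h'')
  then show ?case using red_apps_head reds_is_term[OF R]
    by (meson rtranclp.rtrancl_into_rtrancl)
qed simp

lemma reds_App_arg:
  assumes R: "afsm F R"
  shows "(red F R)\<^sup>*\<^sup>* t t' \<Longrightarrow> is_term F (App s t) \<Longrightarrow> (red F R)\<^sup>*\<^sup>* (App s t) (App s t')"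
proof (induction rule: rtranclp_induct)
  case (step t' t'')
  then show ?case using red.intros(4) reds_is_term[OF R]
    by (meson rtranclp.rtrancl_into_rtrancl)
qed simp

lemma reds_apps_args:
  assumes R: "afsm F R"
  shows "list_all2 (red F R)\<^sup>*\<^sup>* us ws \<Longrightarrow> is_term F (apps h us) \<Longrightarrow> (red F R)\<^sup>*\<^sup>* (apps h us) (apps h ws)"
proof (induction arbitrary: h rule: list_all2_induct)
  case (Cons u us w ws)
  then have "is_term F (apps (App h u) us)" by simp
  then have "(red F R)\<^sup>*\<^sup>* (apps (App h u) us) (apps (App h w) us)"
    using reds_apps_head[OF R] reds_App_arg[OF R Cons(1)] is_term_apps by blast
  moreover from this have "is_term F (apps (App h w) us)"
    using reds_is_term[OF R] Cons.prems by simp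
  ultimately show ?case using Cons.IH[of "App h w"] by simp
qed simp

section \<open>Survival of meta-variable arguments\<close>

text \<open>Induction on \<open>size\<close> rather than on the derivation: the body of an
  abstraction is first opened with a fresh variable, giving a different term of equal size.\<close>

lemma raw_sub_subs: "raw_sub v w \<Longrightarrow> closed_at 0 w \<Longrightarrow> sub\<^sup>*\<^sup>* v w"
proof (induction v rule: measure_induct_rule[where f = size])
  case (less v)
  from less.prems(1) show ?case
  proof cases
    case (2 s t)
    then have "sub\<^sup>*\<^sup>* s w" using less by simp
    then show ?thesis using sub.intros(1) 2(1) by (metis converse_rtranclp_into_rtranclp)
  next
    case (3 t s)
    then have "sub\<^sup>*\<^sup>* t w" using less by simp
    then show ?thesis using sub.intros(2) 3(1) by (metis converse_rtranclp_into_rtranclp)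
  next
    case (4 t \<sigma>)
    obtain y where y: "vty y = \<sigma>" "y \<notin> FV t" by (rule fresh_var)
    have "raw_sub (inst 0 [Free y] t) w" using 4 less.prems raw_sub_inst by blast
    then have "sub\<^sup>*\<^sup>* (inst 0 [Free y] t) w"
      using less 4 by (auto simp: size_inst_Free)
    moreover have "sub v (inst 0 [Free y] t)"
      using lam_inst[OF y(2)] y(1) 4(1) sub.intros(3) by metis
    ultimately show ?thesis by (rule converse_rtranclp_into_rtranclp[rotated])
  qed simp
qed

lemma subs_meta_app:
  assumes v: "v = lams xs t" "distinct xs" "\<not> is_abs t" "FMV v = {}"
    and i: "length xs \<le> i \<or> i < length xs \<and> xs ! i \<in> FV t" "i < length ss"
    and cl: "closed_at 0 (meta_app v ss)"
  shows "sub\<^sup>*\<^sup>* (meta_app v ss) (ss ! i)"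
proof -
  obtain n u where nu: "strip_abs (length ss) v = (n, u)" by fastforce
  let ?h = "inst 0 (rev (take n ss)) u"
  have m: "meta_app v ss = apps ?h (drop n ss)" using nu by (simp add: meta_app_def)
  show ?thesis
  proof (cases "i < n")
    \<comment> \<open>Position \<open>i\<close> lies beyond the \<open>n\<close> contracted binders,
      so its argument remains as an outer application argument.\<close>
    case False
    then have "ss ! i \<in> set (drop n ss)"
      using i(2) nth_mem[of "i - n" "drop n ss"] by simp
    then show ?thesis unfolding m by (rule sub_apps_arg)
  next
    case True
    \<comment> \<open>Together with \<open>i < n\<close> this excludes the alternative
      \<open>length xs \<le> i\<close> and leaves a genuine occurrence of \<open>xs ! i\<close> in
      \<open>t\<close>.\<close>
    have "n \<le> length xs" using strip_abs_lams_le v(1,3) nu by blast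
    then have "occurs (n - 1 - i) u"
      using strip_abs_lams_occurs[of xs i t "length ss" n u] v i True nu by (auto simp: FMV_lams)
    then have occ: "occurs (0 + (n - 1 - i)) u" by simp
    have le: "n \<le> length ss" using strip_abs_le[OF nu] .
    have len: "n - 1 - i < length (rev (take n ss))" using le True by simp
    have nth: "rev (take n ss) ! (n - 1 - i) = ss ! i" using le True by (simp add: rev_nth)
    have "closed_at 0 ?h" using cl m by simp
    from closed_at_inst_occurs[OF this occ len] have c: "closed_at 0 (ss ! i)" using nth by simp
    with raw_sub_inst_occurs[OF occ len] nth have "raw_sub ?h (ss ! i)" by simp
    then have "sub\<^sup>*\<^sup>* ?h (ss ! i)" using c by (rule raw_sub_subs)
    then show ?thesis unfolding m using sub_apps_head by (rule rtranclp_trans[rotated])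
  qed
qed

lemma subst_apps_arg: "t \<in> set ts \<Longrightarrow> sub\<^sup>*\<^sup>* (subst \<gamma> (apps h ts)) (subst \<gamma> t)"
  by (simp add: subst_apps sub_apps_arg)

lemma subs_steps_ex:
  "sub\<^sup>*\<^sup>* s u \<Longrightarrow> \<exists>\<gamma>'. (\<forall>Z. \<gamma>' (Inr Z) = \<gamma> (Inr Z)) \<and> (step F R)\<^sup>*\<^sup>* u (subst \<gamma>' t) \<Longrightarrow>
    \<exists>\<gamma>'. (\<forall>Z. \<gamma>' (Inr Z) = \<gamma> (Inr Z)) \<and> (step F R)\<^sup>*\<^sup>* s (subst \<gamma>' t)"
  using subs_steps rtranclp_trans by meson

text \<open>Passing below an abstraction may rename the bound variable, so only the values of the
  meta-variables persist.\<close>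

lemma beta_sub_steps:
  assumes R: "afsm F R"
  shows "beta_sub A s t \<Longrightarrow> closed_subst \<gamma> \<Longrightarrow> respects_conds \<gamma> A \<Longrightarrow>
    \<forall>Z. Inr Z \<in> sdom \<gamma> \<longrightarrow> FMV (\<gamma> (Inr Z)) = {} \<Longrightarrow> is_term F (subst \<gamma> s) \<Longrightarrow>
    \<exists>\<gamma>'. (\<forall>Z. \<gamma>' (Inr Z) = \<gamma> (Inr Z)) \<and> (step F R)\<^sup>*\<^sup>* (subst \<gamma> s) (subst \<gamma>' t)"
proof (induction arbitrary: \<gamma> rule: beta_sub.induct)
  case (1 s)
  then show ?case by blast
next
  case (2 u t x)
  obtain y where y: "subst \<gamma> (lam x u) = lam y (subst (\<gamma>(Inl x := Free y)) u)"
    using subst_lam[OF 2(3)] by metis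
  let ?\<gamma> = "\<gamma>(Inl x := Free y)"
  have "is_term F (subst ?\<gamma> u)" using 2(6) is_term_lamD y by metis
  moreover have "respects_conds ?\<gamma> A" using 2(4) by (simp add: respects_conds_def)
  moreover have "closed_subst ?\<gamma>" using closed_subst_upd[OF 2(3)] by simp
  moreover have "\<forall>Z. Inr Z \<in> sdom ?\<gamma> \<longrightarrow> FMV (?\<gamma> (Inr Z)) = {}" using 2(5) by simp
  ultimately obtain \<gamma>' where "\<forall>Z. \<gamma>' (Inr Z) = ?\<gamma> (Inr Z)"
      "(step F R)\<^sup>*\<^sup>* (subst ?\<gamma> u) (subst \<gamma>' t)"
    using 2(2)[of ?\<gamma>] by metis
  moreover have "step F R (subst \<gamma> (lam x u)) (subst ?\<gamma> u)"
    unfolding y by (simp add: step_def sub.intros)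
  ultimately show ?case by (metis converse_rtranclp_into_rtranclp fun_upd_other sum.distinct(1))
next
  case (3 s ss t x u)
  have *: "sub\<^sup>*\<^sup>* (subst \<gamma> (apps (lam x u) ss)) (subst \<gamma> s)" using 3(1) by (rule subst_apps_arg)
  show ?case using * 3(3)[OF 3(4-6) subs_is_term[OF * 3(7)]] by (rule subs_steps_ex)
next
  case (4 x s u ss t)
  obtain y where y: "subst \<gamma> (lam x u) = lam y (subst (\<gamma>(Inl x := Free y)) u)"
    "\<And>w. closed_at 0 w \<Longrightarrow> subst1 y w (subst (\<gamma>(Inl x := Free y)) u) = subst (\<gamma>(Inl x := w)) u"
    using subst_lam[OF 4(3)] by metis
  let ?u = "subst (\<gamma>(Inl x := Free y)) u" and ?ss = "map (subst \<gamma>) ss"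
  have eq: "subst \<gamma> (apps (lam x u) (s # ss)) = apps (App (lam y ?u) (subst \<gamma> s)) ?ss"
    by (simp add: subst_apps y(1))
  have tm: "is_term F (apps (App (lam y ?u) (subst \<gamma> s)) ?ss)" using 4(6) eq by simp
  then have tm': "is_term F (App (lam y ?u) (subst \<gamma> s))" using is_term_apps by blast
  then have "closed_at 0 (subst \<gamma> s)" using is_term_App is_term_closed by blast
  \<comment> \<open>The image of the redex contracts to the image of the contractum: both sides are
    \<open>u\<close> under the extension of \<open>\<gamma>\<close> that sends \<open>x\<close> to
    \<open>subst \<gamma> s\<close>.\<close>
  then have "subst1 y (subst \<gamma> s) ?u = subst \<gamma> (subst1 x s u)"
    using y(2) subst_subst1 by metis
  then have "red F R (App (lam y ?u) (subst \<gamma> s)) (subst \<gamma> (subst1 x s u))"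
    using red.intros(2)[OF tm'] by metis
  from red_apps_head[OF this tm]
  have r: "red F R (subst \<gamma> (apps (lam x u) (s # ss))) (subst \<gamma> (apps (subst1 x s u) ss))"
    unfolding eq by (simp add: subst_apps)
  with red_is_term[OF R] 4(6) have "is_term F (subst \<gamma> (apps (subst1 x s u) ss))" by blast
  with 4(2)[OF 4(3,4,5)] r show ?case
    by (metis converse_rtranclp_into_rtranclp step_def)
next
  case (5 s ss t f)
  have *: "sub\<^sup>*\<^sup>* (subst \<gamma> (apps (Fn f) ss)) (subst \<gamma> s)" using 5(1) by (rule subst_apps_arg)
  show ?case using * 5(3)[OF 5(4-6) subs_is_term[OF * 5(7)]] by (rule subs_steps_ex)
next
  case (6 s ss t x)
  have *: "sub\<^sup>*\<^sup>* (subst \<gamma> (apps (Free x) ss)) (subst \<gamma> s)" using 6(1) by (rule subst_apps_arg)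
  show ?case using * 6(3)[OF 6(4-6) subs_is_term[OF * 6(7)]] by (rule subs_steps_ex)
next
  case (7 s ss t Z ts)
  have *: "sub\<^sup>*\<^sup>* (subst \<gamma> (apps (Meta Z ts) ss)) (subst \<gamma> s)" using 7(1) by (rule subst_apps_arg)
  show ?case using * 7(3)[OF 7(4-6) subs_is_term[OF * 7(7)]] by (rule subs_steps_ex)
next
  case (8 Z i ts t ss)
  let ?h = "subst \<gamma> (Meta Z ts)"
  have h: "sub\<^sup>*\<^sup>* (subst \<gamma> (apps (Meta Z ts) ss)) ?h" by (simp add: subst_apps sub_apps_head)
  then have tm: "is_term F ?h" using 8(9) subs_is_term by blast
  \<comment> \<open>Outside the domain, \<open>Z\<close> itself would remain in \<open>?h\<close>,
    which is a term.\<close>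
  then have Z: "Inr Z \<in> sdom \<gamma>" by (auto simp: is_term_def)
  then have eq: "?h = meta_app (\<gamma> (Inr Z)) (map (subst \<gamma>) ts)" by simp
  from 8(1,7) obtain xs v where xs: "\<gamma> (Inr Z) = lams xs v" "distinct xs" "\<not> is_abs v"
    "i > length xs \<or> 1 \<le> i \<and> i \<le> length xs \<and> xs ! (i - 1) \<in> FV v"
    unfolding respects_conds_def by blast
  \<comment> \<open>Conditions number arguments from \<open>1\<close>, lists from
    \<open>0\<close>.\<close>
  have i: "length xs \<le> i - 1 \<or> i - 1 < length xs \<and> xs ! (i - 1) \<in> FV v"
    "i - 1 < length (map (subst \<gamma>) ts)"
    using xs(4) 8(2,3) by auto
  have "closed_at 0 (meta_app (\<gamma> (Inr Z)) (map (subst \<gamma>) ts))"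
    using is_term_closed[OF tm] eq by simp
  from subs_meta_app[OF xs(1-3) 8(8)[rule_format, OF Z] i this]
  have "sub\<^sup>*\<^sup>* ?h (subst \<gamma> (ts ! (i - 1)))" unfolding eq using i(2) by simp
  with h have *: "sub\<^sup>*\<^sup>* (subst \<gamma> (apps (Meta Z ts) ss)) (subst \<gamma> (ts ! (i - 1)))" by (rule rtranclp_trans)
  show ?case using * 8(5)[OF 8(6-8) subs_is_term[OF * 8(9)]] by (rule subs_steps_ex)
qed

section \<open>Erasure on substitutions and reductions\<close>

lemma foldr_Abs_unmark: "unmark (foldr Abs \<sigma>s t) = foldr Abs \<sigma>s (unmark t)"
  by (induction \<sigma>s) auto

lemma FMV_foldr_Abs: "FMV (foldr Abs \<sigma>s t) = FMV t"
  by (induction \<sigma>s) auto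

lemma unmark_lam: "unmark (lam x t) = lam x (unmark t)"
  by (simp add: lam_def unmark_bind)

lemma unmark_lams: "unmark (lams xs t) = lams xs (unmark t)"
  by (induction xs) (simp_all add: unmark_lam)

lemma unmark_meta_id: "unmark (meta_id Z) = meta_id Z"
  by (simp add: meta_id_def foldr_Abs_unmark o_def)

lemma FMV_meta_id: "FMV (meta_id Z) = {Z}"
  by (auto simp: meta_id_def FMV_foldr_Abs)

text \<open>Domains are defined by comparison with \<open>meta_id\<close>, so erasure must not
  create new equalities; it cannot, since it keeps meta-variables and \<open>meta_id Z\<close>
  contains \<open>Z\<close>.\<close>

lemma unmark_eq_meta_id:
  assumes "t \<noteq> meta_id Z \<longrightarrow> FMV t = {}"
  shows "unmark t = meta_id Z \<longleftrightarrow> t = meta_id Z"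
  using assms by (metis FMV_meta_id FMV_unmark insert_not_empty unmark_meta_id)

lemma unmark_subst:
  assumes "\<forall>Z. Inr Z \<in> sdom \<gamma> \<longrightarrow> FMV (\<gamma> (Inr Z)) = {}"
  shows "unmark (subst \<gamma> t) = subst (unmark \<circ> \<gamma>) (unmark t)"
proof (induction t)
  case (Meta Z ts)
  have "unmark (\<gamma> (Inr Z)) = meta_id Z \<longleftrightarrow> \<gamma> (Inr Z) = meta_id Z"
    using assms by (intro unmark_eq_meta_id) simp
  with Meta show ?case by (simp add: unmark_meta_app o_def cong: map_cong)
qed auto

lemma unmark_subst1: "unmark (subst1 x t s) = subst1 x (unmark t) (unmark s)"
proof -
  have "unmark \<circ> var_subst (Free(x := t)) = var_subst (Free(x := unmark t))"
    by (auto simp: fun_eq_iff var_subst_def unmark_meta_id split: sum.splits)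
  then show ?thesis unfolding subst1_def by (subst unmark_subst) auto
qed

lemma has_type_unmark: "has_type (sharp_sig F R) \<Gamma> t \<sigma> \<Longrightarrow> has_type F \<Gamma> (unmark t) \<sigma>"
proof (induction rule: has_type.induct)
  case (3 f \<sigma> \<Gamma>)
  then show ?case by (cases f) (auto intro: has_type.intros split: if_splits)
next
  case (6 ss Z \<sigma>s \<tau> \<Gamma>)
  have "list_all2 (has_type F \<Gamma>) (map unmark ss) \<sigma>s"
    unfolding list_all2_map1 using "6.IH" by (rule list_all2_mono) simp
  with 6(1,2) show ?case by (simp add: has_type.intros(6))
qed (auto intro: has_type.intros)

lemma is_term_unmark: "is_term (sharp_sig F R) t \<Longrightarrow> is_term F (unmark t)"
  by (auto simp: is_term_def is_mterm_def dest: has_type_unmark)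

lemma is_subst_FMV: "is_subst F \<gamma> \<Longrightarrow> \<forall>Z. Inr Z \<in> sdom \<gamma> \<longrightarrow> FMV (\<gamma> (Inr Z)) = {}"
  unfolding is_subst_def is_term_def by blast

lemma sdom_unmark:
  assumes "is_subst F \<gamma>"
  shows "Inr Z \<in> sdom (unmark \<circ> \<gamma>) \<longleftrightarrow> Inr Z \<in> sdom \<gamma>"
  using is_subst_FMV[OF assms] unmark_eq_meta_id[of "\<gamma> (Inr Z)" Z] by simp

text \<open>A rule step prescribes the exact domain of its substitution; this carries the
  prescription over to the erased substitution.\<close>

lemma sdom_unmark_eq:
  assumes "is_subst F \<gamma>" "sdom \<gamma> = Inr ` M"
  shows "sdom (unmark \<circ> \<gamma>) = Inr ` M"
proof -
  have "\<gamma> (Inl x) = Free x" for x using assms(2) by (auto simp: sdom_def)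
  then have "Inl x \<notin> sdom (unmark \<circ> \<gamma>)" for x by (simp add: sdom_def)
  moreover have "Inr Z \<in> sdom (unmark \<circ> \<gamma>) \<longleftrightarrow> Z \<in> M" for Z
    using sdom_unmark[OF assms(1), of Z] assms(2) by (simp add: image_iff del: sdom_Inr)
  ultimately have "a \<in> sdom (unmark \<circ> \<gamma>) \<longleftrightarrow> a \<in> Inr ` M" for a by (cases a) auto
  then show ?thesis by blast
qed

lemma is_subst_unmark:
  assumes "is_subst (sharp_sig F R) \<gamma>"
  shows "is_subst F (unmark \<circ> \<gamma>)"
proof -
  have "is_term F (unmark (\<gamma> a))" if "a \<in> sdom (unmark \<circ> \<gamma>)" for a
  proof -
    have "a \<in> sdom \<gamma>" using that by (auto simp: sdom_def unmark_meta_id)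
    then have "is_term (sharp_sig F R) (\<gamma> a)" using assms by (simp add: is_subst_def)
    then show ?thesis by (rule is_term_unmark)
  qed
  then show ?thesis using assms has_type_unmark unfolding is_subst_def by fastforce
qed

lemma respects_conds_unmark: "respects_conds \<gamma> A \<Longrightarrow> respects_conds (unmark \<circ> \<gamma>) A"
  unfolding respects_conds_def
  by (clarsimp, drule bspec, assumption, clarsimp)
    (metis FV_unmark is_abs_unmark unmark_lams)

lemma red_unmark: "red (sharp_sig F R) (plain_rules R) s s' \<Longrightarrow> red F R (unmark s) (unmark s')"
proof (induction rule: red.induct)
  case (1 l r \<delta>)
  from 1(1) obtain l' r' where lr: "l = plain l'" "r = plain r'" "(l', r') \<in> R"
    by (auto simp: plain_rules_def)
  have "red F R (subst (unmark \<circ> \<delta>) l') (subst (unmark \<circ> \<delta>) r')"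
    using lr(3) is_subst_unmark[OF 1(2)]
    by (rule red.intros(1)) (use sdom_unmark_eq[OF 1(2,3)] lr(1) in simp)
  then show ?case using unmark_subst[OF is_subst_FMV[OF 1(2)]] lr by simp
next
  case (2 x s t)
  then show ?case using is_term_unmark[OF 2] by (auto simp: unmark_lam unmark_subst1 intro: red.intros)
next
  case (3 s s' t)
  then show ?case using is_term_unmark[OF 3(2)] by (auto intro: red.intros)
next
  case (4 t t' s)
  then show ?case using is_term_unmark[OF 4(2)] by (auto intro: red.intros)
next
  case (5 s s' x)
  then show ?case by (simp add: unmark_lam red.intros)
qed

lemma reds_unmark:
  "(red (sharp_sig F R) (plain_rules R))\<^sup>*\<^sup>* s s' \<Longrightarrow> (red F R)\<^sup>*\<^sup>* (unmark s) (unmark s')"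
  by (induction rule: rtranclp_induct) (auto dest: red_unmark intro: rtranclp.rtrancl_into_rtrancl)

section \<open>Conservative dependency pairs\<close>

lemma is_sharp_simps:
  assumes "is_sharp R minar s s'"
  shows "unmark s' = s" "FMV s' = FMV s" "FV s' = FV s"
proof -
  from assms show "unmark s' = s" by (auto simp: is_sharp_def unmark_apps o_def)
  from this FMV_unmark[of s'] FV_unmark[of s'] show "FMV s' = FMV s" "FV s' = FV s" by auto
qed

text \<open>Conservativity excludes the fresh meta-variables that replace free variables.\<close>

lemma conservative_SDP:
  assumes "(l', q, A) \<in> SDP R minar" "conservative (l', q, A)"
  obtains l r p where "(l, r) \<in> R" "(p, A) \<in> cand R minar r" "unmark l' = l" "unmark q = p" "FV p = {}"
proof -
  from assms(1) obtain l r p p' where *: "(l, r) \<in> R" "(p, A) \<in> cand R minar r"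
    "is_sharp R minar l l'" "is_sharp R minar p p'" "is_metafy (FMV l' \<union> FMV p' \<union> fst ` A) p' q"
    unfolding SDP_def by blast
  from *(5) obtain \<xi> where \<xi>: "\<And>x. x \<in> FV p' \<Longrightarrow> \<xi> x \<notin> FMV l'"
    "q = subst (var_subst (\<lambda>x. if x \<in> FV p' then Meta (\<xi> x) [] else Free x)) p'"
    unfolding is_metafy_def by blast
  have "x \<notin> FV p'" for x
  proof
    assume x: "x \<in> FV p'"
    then have "\<xi> x \<in> FMV q"
      using FMV_subst_var[OF x, of "\<lambda>x. if x \<in> FV p' then Meta (\<xi> x) [] else Free x"] \<xi>(2) by auto
    then show False using assms(2) \<xi>(1)[OF x] by (auto simp: conservative_def)
  qed
  then have FV: "FV p' = {}" by blast
  then have "q = p'" using \<xi>(2) by simp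
  then show ?thesis using that *(1,2) is_sharp_simps[OF *(3)] is_sharp_simps[OF *(4)] FV by metis
qed

lemma conservative_chain_step:
  assumes R: "afsm F R"
    and dp: "(l', q, A) \<in> SDP R minar" "conservative (l', q, A)"
    and \<gamma>: "is_subst (sharp_sig F R) \<gamma>" "sdom \<gamma> = Inr ` (FMV l' \<union> FMV q)" "respects_conds \<gamma> A"
    and tm: "is_term (sharp_sig F R) (subst \<gamma> l')"
  obtains u where "red F R (unmark (subst \<gamma> l')) u" "(step F R)\<^sup>*\<^sup>* u (unmark (subst \<gamma> q))"
proof -
  obtain l r p where lr: "(l, r) \<in> R" "(p, A) \<in> cand R minar r" "unmark l' = l" "unmark q = p" "FV p = {}"
    using conservative_SDP[OF dp] by metis
  let ?\<gamma> = "unmark \<circ> \<gamma>"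
  have sub: "is_subst F ?\<gamma>" using is_subst_unmark[OF \<gamma>(1)] .
  \<comment> \<open>Conservativity reduces the domain of \<open>\<gamma>\<close> to that required
    for contracting \<open>l\<close>.\<close>
  have "FMV l' \<union> FMV q = FMV l" using dp(2) lr(3) by (auto simp: conservative_def)
  then have dom: "sdom ?\<gamma> = Inr ` FMV l" using sdom_unmark_eq[OF \<gamma>(1,2)] by simp
  have l: "unmark (subst \<gamma> l') = subst ?\<gamma> l" and p: "unmark (subst \<gamma> q) = subst ?\<gamma> p"
    using unmark_subst[OF is_subst_FMV[OF \<gamma>(1)]] lr(3,4) by simp_all
  have r: "red F R (unmark (subst \<gamma> l')) (subst ?\<gamma> r)"
    unfolding l using lr(1) sub dom by (rule red.intros(1))
  then have "is_term F (subst ?\<gamma> r)" using red_is_term[OF R] is_term_unmark[OF tm] by blast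
  moreover from lr(2) obtain us where "beta_sub A r (apps p us)" unfolding cand_def by blast
  ultimately obtain \<gamma>' where \<gamma>': "\<forall>Z. \<gamma>' (Inr Z) = ?\<gamma> (Inr Z)"
    "(step F R)\<^sup>*\<^sup>* (subst ?\<gamma> r) (subst \<gamma>' (apps p us))"
    using beta_sub_steps[OF R _ is_subst_closed[OF sub] respects_conds_unmark[OF \<gamma>(3)]]
      is_subst_FMV[OF sub] by blast
  \<comment> \<open>\<open>\<gamma>'\<close> is only known to agree with \<open>?\<gamma>\<close> on
    meta-variables, which suffices because \<open>p\<close> has no free variables.\<close>
  have "subst \<gamma>' p = subst ?\<gamma> p" by (rule subst_cong) (use lr(5) \<gamma>'(1) in auto)
  \<comment> \<open>A candidate may drop trailing arguments \<open>us\<close>; going to the head of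
    the application removes them.\<close>
  then have "sub\<^sup>*\<^sup>* (subst \<gamma>' (apps p us)) (subst ?\<gamma> p)"
    using sub_apps_head by (simp add: subst_apps)
  with \<gamma>'(2) have "(step F R)\<^sup>*\<^sup>* (subst ?\<gamma> r) (unmark (subst \<gamma> q))"
    unfolding p using subs_steps rtranclp_trans by meson
  with r that show thesis by blast
qed

section \<open>Building the infinite reduction\<close>

text \<open>The chain elements shrink by subterm steps, so the argument follows surrounding terms
  instead: each reduces, in at least one rewrite step, to a term containing the next chain
  element.\<close>

lemma not_terminating_if_red_steps:
  assumes R: "afsm F R" and tm: "\<And>i. is_term F (a i)"
    and st: "\<And>i. \<exists>b. red F R (a i) b \<and> (step F R)\<^sup>*\<^sup>* b (a (Suc i))"
  shows "\<not> terminating F R"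
proof
  assume "terminating F R"
  then have "wf {(t, s). red F R s t}"
    unfolding terminating_def wf_iff_no_infinite_down_chain by simp
  then have wf: "wf ({(t, s). red F R s t}\<^sup>+)" by (rule wf_trancl)
  \<comment> \<open>Stated for every \<open>u\<close> containing some \<open>a i\<close>, with
    \<open>i\<close> arbitrary, since the induction moves to a reduct of \<open>u\<close> and to
    index \<open>Suc i\<close>.\<close>
  have "\<not> (is_term F u \<and> sub\<^sup>*\<^sup>* u (a i))" for u i
    using wf
  proof (induction u arbitrary: i rule: wf_induct_rule)
    case (less u)
    show ?case
    proof
      assume u: "is_term F u \<and> sub\<^sup>*\<^sup>* u (a i)"
      obtain b where b: "red F R (a i) b" "(step F R)\<^sup>*\<^sup>* b (a (Suc i))" using st by blast
      \<comment> \<open>This lifted step makes the descent strict; the part from \<open>b\<close> to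
        \<open>a (Suc i)\<close> may contain no rewrite step.\<close>
      obtain v where v: "red F R u v" "sub\<^sup>*\<^sup>* v b" using subs_red b(1) u by blast
      then have "is_term F v" using red_is_term[OF R] u by blast
      with subs_steps_commute[OF R b(2) v(2)] obtain w where w: "(red F R)\<^sup>*\<^sup>* v w" "sub\<^sup>*\<^sup>* w (a (Suc i))"
        by blast
      have "is_term F w" using reds_is_term[OF R w(1)] \<open>is_term F v\<close> by blast
      moreover have "(w, u) \<in> {(t, s). red F R s t}\<^sup>+"
        using w(1)
      proof (induction rule: rtranclp_induct)
        case base
        show ?case using v(1) by blast
      next
        case (step y z)
        then have "(z, y) \<in> {(t, s). red F R s t}" by simp
        then show ?case using step.IH by (rule trancl_into_trancl2)
      qed
      ultimately show False using less w(2) by blast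
    qed
  qed
  then show False using tm by blast
qed

lemma conservative_chain_not_terminating:
  assumes R: "afsm F R"
    and chain: "infinite_chain (sharp_sig F R) (SDP R minar) (plain_rules R) (\<lambda>i. (\<rho> i, s i, t i))"
    and cons: "\<forall>i. conservative (\<rho> i)"
  shows "\<not> terminating F R"
proof (rule not_terminating_if_red_steps[OF R])
  fix i
  obtain l q A where \<rho>: "\<rho> i = (l, q, A)" by (cases "\<rho> i") auto
  from spec[OF chain[unfolded infinite_chain_def], of i]
  obtain \<gamma> where dp: "(l, q, A) \<in> SDP R minar"
    and tm: "is_term (sharp_sig F R) (s i)" "is_term (sharp_sig F R) (t i)"
    and \<gamma>: "is_subst (sharp_sig F R) \<gamma>" "sdom \<gamma> = Inr ` (FMV l \<union> FMV q)" "respects_conds \<gamma> A"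
    and st: "s i = subst \<gamma> l" "t i = subst \<gamma> q"
    and next_args: "\<exists>f us ws. t i = apps (Fn f) us \<and> s (Suc i) = apps (Fn f) ws \<and>
      list_all2 (red (sharp_sig F R) (plain_rules R))\<^sup>*\<^sup>* us ws"
    unfolding \<rho> prod.case fst_conv snd_conv by blast
  show "is_term F (unmark (s i))" using is_term_unmark[OF tm(1)] .
  have "conservative (l, q, A)" using cons \<rho> by metis
  then obtain b where b: "red F R (unmark (s i)) b" "(step F R)\<^sup>*\<^sup>* b (unmark (t i))"
    using conservative_chain_step[OF R dp _ \<gamma>] tm(1) unfolding st by metis
  from next_args obtain f us ws where f: "t i = apps (Fn f) us" "s (Suc i) = apps (Fn f) ws"
    "list_all2 (red (sharp_sig F R) (plain_rules R))\<^sup>*\<^sup>* us ws" by blast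
  have "list_all2 (red F R)\<^sup>*\<^sup>* (map unmark us) (map unmark ws)"
    unfolding list_all2_map1 list_all2_map2 using f(3) by (rule list_all2_mono) (rule reds_unmark)
  moreover have "is_term F (apps (unmark (Fn f)) (map unmark us))"
    using is_term_unmark[OF tm(2)] f(1) by (simp add: unmark_apps)
  ultimately have "(red F R)\<^sup>*\<^sup>* (unmark (t i)) (unmark (s (Suc i)))"
    \<comment> \<open>Consecutive chain elements share their head symbol, so reducing the arguments
      alone connects them after erasure.\<close>
    unfolding f(1,2) unmark_apps by (rule reds_apps_args[OF R])
  then show "\<exists>b. red F R (unmark (s i)) b \<and> (step F R)\<^sup>*\<^sup>* b (unmark (s (Suc i)))"
    using b reds_steps rtranclp_trans by meson
qed

end

theorem theorem34:
  fixes vty :: "'v \<Rightarrow> 's ty"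
    and mty :: "'m \<Rightarrow> 's ty"
    and arity :: "'m \<Rightarrow> nat"
    and F :: "('f, 's) sig"
    and R :: "('f, 'v, 'm, 's) rule set"
    and minar :: "'f \<Rightarrow> nat"
    and \<rho> :: "nat \<Rightarrow> ('f marked, 'v, 'm, 's) dp"
    and s t :: "nat \<Rightarrow> ('f marked, 'v, 'm, 's) mterm"
  assumes "symbols vty mty arity"
    and "symbols.afsm vty mty arity F R"
    and "symbols.infinite_chain vty mty arity (sharp_sig F R) (symbols.SDP vty mty arity R minar)
      (plain_rules R) (\<lambda>i. (\<rho> i, s i, t i))"
    and "\<forall>i. conservative (\<rho> i)"
  shows "\<not> symbols.terminating vty mty arity F R"
  using assms by (rule symbols.conservative_chain_not_terminating)

end
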